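(* Assume that $\mathrm{avg}(i,j)$ can be evaluated in $O(1)$ time for any $1\le i<j\le n+1$. Then Algorithm 2 can be implemented to run in $O(n\log n)$ time on any instance of Problem (P) with $n$ variables.
   Context: Problem (P): given an integer $n\ge1$, reals $0<q_1\le\cdots\le q_n$, $z_1,\dots,z_n>0$ and $K>0$, maximize $\sum_{i=1}^n x_i$ subject to $0\le x_i\le q_i$, $0\le x_1\le\cdots\le x_n$, $\sum_{i=1}^n z_ix_i\le K$. For $1\le i<j\le n+1$ let $\mathrm{sum}(i,j)=z_i+\cdots+z_{j-1}$ and $\mathrm{avg}(i,j)=\mathrm{sum}(i,j)/(j-i)$. (In the motivating instance, $z_i=(n-i)(1/q_i-1/q_{i+1})+1/q_i$ for $i<n$ and $z_n=1/q_n$, so $\mathrm{sum}(i,j)=(n-i+1)/q_i-(n-j+1)/q_j$ for $j\le n$ and $\mathrm{sum}(i,n+1)=(n-i+1)/q_i$.) Algorithm 2: Set $S=\{0,n+1\}$, $b_n=n+1$, $y_n=z_n$, $x_n=0$. For $i=n-1$ down to $1$: set $b_i=i+1$; while $b_i\ne n+1$ and $\mathrm{avg}(i,b_i)\le\mathrm{avg}(b_i,b_{b_i})$, set $b_i\leftarrow b_{b_i}$; then set $y_i=\mathrm{avg}(i,b_i)$ and $x_i=0$. Set $\hat B=K$. While $\hat B>0$ and $S\ne\{0,1,\dots,n+1\}$: let $i^*$ be the index $i\in\{1,\dots,n\}\setminus S$ minimizing $y_i$, ties broken in favour of the smallest index; set $d=\min\{\hat B/((b_{i^*}-i^* )y_{i^*}),\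 q_{i^*}-x_{i^*}\}$; set $\hat B\leftarrow\hat B-d(b_{i^*}-i^* )y_{i^*}$; add $d$ to $x_i$ for all $i^*\le i<b_{i^*}$; add $i^*$ to $S$. Output $x_1,\dots,x_n$. *)

theory Defs
  imports Complex_Main
begin

definition zsum :: "(nat \<Rightarrow> real) \<Rightarrow> nat \<Rightarrow> nat \<Rightarrow> real" where
  "zsum z i j = (\<Sum>k = i..<j. z k)"

definition avg :: "(nat \<Rightarrow> real) \<Rightarrow> nat \<Rightarrow> nat \<Rightarrow> real" where
  "avg z i j = zsum z i j / real (j - i)"

text \<open>Inner while-loop of the first phase: starting from c, repeatedly replace c by b c
  while c differs from n+1 and avg(i,c) \<le> avg(c, b c).  Since b c > c, at most n+1
  iterations occur, so a fuel of n+1 suffices.\<close>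
fun jumpf :: "(nat \<Rightarrow> real) \<Rightarrow> nat \<Rightarrow> (nat \<Rightarrow> nat) \<Rightarrow> nat \<Rightarrow> nat \<Rightarrow> nat \<Rightarrow> nat" where
  "jumpf z n b i 0 c = c"
| "jumpf z n b i (Suc k) c =
     (if c \<noteq> n + 1 \<and> avg z i c \<le> avg z c (b c) then jumpf z n b i k (b c) else c)"

definition bstep :: "(nat \<Rightarrow> real) \<Rightarrow> nat \<Rightarrow> (nat \<Rightarrow> nat) \<Rightarrow> nat \<Rightarrow> (nat \<Rightarrow> nat)" where
  "bstep z n b i = b(i := jumpf z n b i (n + 1) (i + 1))"

definition barr :: "(nat \<Rightarrow> real) \<Rightarrow> nat \<Rightarrow> (nat \<Rightarrow> nat)" where
  "barr z n = foldl (bstep z n) (\<lambda>_. n + 1) (rev [1..<n])"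

definition yv :: "(nat \<Rightarrow> real) \<Rightarrow> nat \<Rightarrow> nat \<Rightarrow> real" where
  "yv z n i = avg z i (barr z n i)"

definition gstep :: "(nat \<Rightarrow> real) \<Rightarrow> (nat \<Rightarrow> real) \<Rightarrow> nat \<Rightarrow>
    nat set \<times> (nat \<Rightarrow> real) \<times> real \<Rightarrow> nat set \<times> (nat \<Rightarrow> real) \<times> real" where
  "gstep q z n st =
     (case st of (S, x, B) \<Rightarrow>
       (let R = {1..n} - S; b = barr z n; y = yv z n in
        if B > 0 \<and> R \<noteq> {} then
          (let i = (LEAST i. i \<in> R \<and> (\<forall>j\<in>R. y i \<le> y j));
               d = min (B / (real (b i - i) * y i)) (q i - x i)
           in (insert i S,
               (\<lambda>k. if i \<le> k \<and> k < b i then x k + d else x k),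
               B - d * real (b i - i) * y i))
        else (S, x, B)))"

text \<open>Output of Algorithm 2 (the greedy loop stops after at most n productive iterations).\<close>
definition alg2 :: "(nat \<Rightarrow> real) \<Rightarrow> (nat \<Rightarrow> real) \<Rightarrow> nat \<Rightarrow> real \<Rightarrow> nat \<Rightarrow> real" where
  "alg2 q z n K = fst (snd ((gstep q z n ^^ n) ({0, n + 1}, (\<lambda>_. 0), K)))"

definition instance_P :: "nat \<Rightarrow> (nat \<Rightarrow> real) \<Rightarrow> (nat \<Rightarrow> real) \<Rightarrow> real \<Rightarrow> bool" where
  "instance_P n q z K \<longleftrightarrow> n \<ge> 1 \<and> (\<forall>i\<in>{1..n}. 0 < q i \<and> 0 < z i)
     \<and> (\<forall>i j. 1 \<le> i \<longrightarrow> i \<le> j \<longrightarrow> j \<le> n \<longrightarrow> q i \<le> q j) \<and> K > 0"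

text \<open>Integer memory im and real memory rm, both indexed by nat; every instruction costs
  one time unit.  Operands are memory cells (direct addressing); indirect loads/stores
  use the integer contents of a cell as an address.  There is no real-to-integer
  conversion (no floor) and no integer multiplication.  The instruction Avg queries the
  oracle avg(i,j), which is charged unit cost.\<close>
datatype instr =
    IConst nat int
  | IAdd nat nat nat
  | ISub nat nat nat
  | ILoadInd nat nat
  | IStoreInd nat nat
  | IJumpLe nat nat nat
  | RConst nat int
  | RAdd nat nat nat
  | RSub nat nat nat
  | RMul nat nat nat
  | RDiv nat nat nat
  | RLoadInd nat nat
  | RStoreInd nat nat
  | RJumpLe nat nat nat
  | OfInt nat nat
  | Avg nat nat nat
  | Jmp nat
  | Halt

record mstate =
  pc :: nat
  im :: "nat \<Rightarrow> int"
  rm :: "nat \<Rightarrow> real"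

definition halted :: "instr list \<Rightarrow> mstate \<Rightarrow> bool" where
  "halted P s \<longleftrightarrow> pc s \<ge> length P \<or> P ! pc s = Halt"

fun exec_instr :: "(nat \<Rightarrow> nat \<Rightarrow> real) \<Rightarrow> instr \<Rightarrow> mstate \<Rightarrow> mstate" where
  "exec_instr orc (IConst a c) s = s\<lparr>pc := Suc (pc s), im := (im s)(a := c)\<rparr>"
| "exec_instr orc (IAdd a b c) s = s\<lparr>pc := Suc (pc s), im := (im s)(a := im s b + im s c)\<rparr>"
| "exec_instr orc (ISub a b c) s = s\<lparr>pc := Suc (pc s), im := (im s)(a := im s b - im s c)\<rparr>"
| "exec_instr orc (ILoadInd a b) s = s\<lparr>pc := Suc (pc s), im := (im s)(a := im s (nat (im s b)))\<rparr>"
| "exec_instr orc (IStoreInd a b) s = s\<lparr>pc := Suc (pc s), im := (im s)(nat (im s a) := im s b)\<rparr>"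
| "exec_instr orc (IJumpLe a b t) s = s\<lparr>pc := (if im s a \<le> im s b then t else Suc (pc s))\<rparr>"
| "exec_instr orc (RConst a c) s = s\<lparr>pc := Suc (pc s), rm := (rm s)(a := of_int c)\<rparr>"
| "exec_instr orc (RAdd a b c) s = s\<lparr>pc := Suc (pc s), rm := (rm s)(a := rm s b + rm s c)\<rparr>"
| "exec_instr orc (RSub a b c) s = s\<lparr>pc := Suc (pc s), rm := (rm s)(a := rm s b - rm s c)\<rparr>"
| "exec_instr orc (RMul a b c) s = s\<lparr>pc := Suc (pc s), rm := (rm s)(a := rm s b * rm s c)\<rparr>"
| "exec_instr orc (RDiv a b c) s = s\<lparr>pc := Suc (pc s), rm := (rm s)(a := rm s b / rm s c)\<rparr>"
| "exec_instr orc (RLoadInd a b) s = s\<lparr>pc := Suc (pc s), rm := (rm s)(a := rm s (nat (im s b)))\<rparr>"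
| "exec_instr orc (RStoreInd a b) s = s\<lparr>pc := Suc (pc s), rm := (rm s)(nat (im s a) := rm s b)\<rparr>"
| "exec_instr orc (RJumpLe a b t) s = s\<lparr>pc := (if rm s a \<le> rm s b then t else Suc (pc s))\<rparr>"
| "exec_instr orc (OfInt a b) s = s\<lparr>pc := Suc (pc s), rm := (rm s)(a := of_int (im s b))\<rparr>"
| "exec_instr orc (Avg a b c) s =
     s\<lparr>pc := Suc (pc s), rm := (rm s)(a := orc (nat (im s b)) (nat (im s c)))\<rparr>"
| "exec_instr orc (Jmp t) s = s\<lparr>pc := t\<rparr>"
| "exec_instr orc Halt s = s"

definition step :: "(nat \<Rightarrow> nat \<Rightarrow> real) \<Rightarrow> instr list \<Rightarrow> mstate \<Rightarrow> mstate" where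
  "step orc P s = (if halted P s then s else exec_instr orc (P ! pc s) s)"

definition avg_oracle :: "(nat \<Rightarrow> real) \<Rightarrow> nat \<Rightarrow> nat \<Rightarrow> nat \<Rightarrow> real" where
  "avg_oracle z n i j = (if 1 \<le> i \<and> i < j \<and> j \<le> n + 1 then avg z i j else 0)"

text \<open>Input encoding: im 0 = n, rm 0 = K, rm i = q i and rm (n+i) = z i for 1 \<le> i \<le> n,
  all other cells 0, pc = 0.  Output: rm i = x_i for 1 \<le> i \<le> n on halting.\<close>
definition init_state :: "nat \<Rightarrow> (nat \<Rightarrow> real) \<Rightarrow> (nat \<Rightarrow> real) \<Rightarrow> real \<Rightarrow> mstate" where
  "init_state n q z K =
     \<lparr>pc = 0, im = (\<lambda>a. if a = 0 then int n else 0),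
      rm = (\<lambda>a. if a = 0 then K
                 else if a \<le> n then q a
                 else if a \<le> 2 * n then z (a - n) else 0)\<rparr>"

end

theory Submission
  imports Defs
begin

text \<open>
  The blocks \<open>{i..<b i}\<close> form a laminar family, and \<open>y\<close> does not decrease when passing to an inner
  block. Hence the greedy loop settles every block after the blocks containing it: when \<open>i\<close> is
  picked, \<open>x\<close> has the same value at \<open>i\<close> as at the start of the innermost block around \<open>i\<close> (its
  parent), where it is already final. Once the budget is exhausted all further increments are
  \<open>0\<close>, because \<open>q\<close> is monotone. So the output is obtained by visiting the indices in the order of
  \<open>(y i, i)\<close>, at constant cost per index plus the cost of finding the next one, which a tournament
  tree does in \<open>O(log n)\<close>. The first phase takes \<open>O(n)\<close>, since every jump over \<open>c\<close> gives \<open>c\<close> its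
  only parent.

  The machine program is obtained by compiling a structured program over named registers and arrays;
  the compiler preserves the exact number of steps, which the source semantics records as a clock.
\<close>

section \<open>A structured language and its compilation\<close>

text \<open>Carried out literally, the greedy loop is quadratic: it adds \<open>d\<close> to a whole
  block, and for increasing \<open>z\<close> every block reaches up to n + 1. The parent removes
  these writes. A block other than that of i contains i exactly when it contains the parent of i, so
  i and its parent collect the same increments until i is picked, and one read at the parent
  replaces all writes inside blocks. A tournament tree suits the weak arithmetic of the machine:
  every index keeps its leaf, and settling an index is one change of key followed by repairs along
  one path to the root. Time bounds are inequalities on the clock inside the loop invariants, and
  the numerals in them are instruction counts.\<close>

datatype ireg = iN | iI | iC | iD | iU | iV | iA | iJ | iOne | iZero | iTwo
datatype rreg = fB | fX | fY | fL | fM | fBig | fZero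
datatype iarr = Bnd | Par | Win | Half
datatype rarr = Val | Key

text \<open>\<open>iN\<close> gets cell 0, where the input encoding puts n, and \<open>rcell\<close>
  gives \<open>fB\<close> cell 0, which holds K when the compiled code starts.\<close>

fun icell :: "ireg \<Rightarrow> nat" where
  "icell iN = 0" | "icell iI = 1" | "icell iC = 2" | "icell iD = 3" | "icell iU = 4"
| "icell iV = 5" | "icell iA = 6" | "icell iJ = 7" | "icell iOne = 8" | "icell iZero = 9"
| "icell iTwo = 10"

fun rcell :: "rreg \<Rightarrow> nat" where
  "rcell fB = 0" | "rcell fX = 1" | "rcell fY = 2" | "rcell fL = 3" | "rcell fM = 4"
| "rcell fBig = 5" | "rcell fZero = 6"

text \<open>The arrays are interleaved, element \<open>k\<close> being stored in cell \<open>4 k + offset\<close>, so that each of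
  them is unbounded. Cells 12 and 13 of the integer memory are used for address computations.\<close>

fun ioff :: "iarr \<Rightarrow> nat" where
  "ioff Bnd = 16" | "ioff Par = 17" | "ioff Win = 18" | "ioff Half = 19"

fun roff :: "rarr \<Rightarrow> nat" where
  "roff Val = 16" | "roff Key = 17"

lemma icell_eq [simp]: "icell r = icell r' \<longleftrightarrow> r = r'"
  by (cases r; cases r'; simp)

lemma rcell_eq [simp]: "rcell r = rcell r' \<longleftrightarrow> r = r'"
  by (cases r; cases r'; simp)

lemma icell_less: "icell r < 12"
  by (cases r) auto

lemma rcell_less: "rcell r < 12"
  by (cases r) auto

lemma ioff_bounds: "16 \<le> ioff a" "ioff a < 20"
  by (cases a; simp)+

lemma roff_bounds: "16 \<le> roff a" "roff a < 20"
  by (cases a; simp)+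

lemma iadr_eq: "4 * k + ioff a = 4 * k' + ioff a' \<longleftrightarrow> k = k' \<and> a = a'"
  by (cases a; cases a'; simp; presburger)

lemma radr_eq: "4 * k + roff a = 4 * k' + roff a' \<longleftrightarrow> k = k' \<and> a = a'"
  by (cases a; cases a'; simp; presburger)

lemma icell_neq [simp]:
  "icell r \<noteq> 12" "icell r \<noteq> 13" "12 \<noteq> icell r" "13 \<noteq> icell r"
  "icell r \<noteq> 4 * k + ioff a" "4 * k + ioff a \<noteq> icell r"
  "4 * k + ioff a \<noteq> 12" "4 * k + ioff a \<noteq> 13"
  using icell_less[of r] ioff_bounds[of a] by auto

lemma rcell_neq [simp]:
  "rcell r \<noteq> 4 * k + roff a" "4 * k + roff a \<noteq> rcell r"
  using rcell_less[of r] roff_bounds[of a] by auto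

section \<open>Source states and clocked semantics\<close>

record st =
  clk :: nat
  ir :: "ireg \<Rightarrow> nat"
  ia :: "iarr \<Rightarrow> nat \<Rightarrow> nat"
  rr :: "rreg \<Rightarrow> real"
  ra :: "rarr \<Rightarrow> nat \<Rightarrow> real"

datatype op =
    ISet ireg nat
  | IPlus ireg ireg ireg
  | IMinus ireg ireg ireg
  | ILd ireg iarr ireg
  | ISt iarr ireg ireg
  | RSet rreg nat
  | RPlus rreg rreg rreg
  | RMinus rreg rreg rreg
  | RTimes rreg rreg rreg
  | ROver rreg rreg rreg
  | RLd rreg rarr ireg
  | RSt rarr ireg rreg
  | ROf rreg ireg
  | RAvg rreg ireg ireg

datatype cnd = ILe ireg ireg | RLe rreg rreg

datatype com =
    Op op
  | Skip
  | Seq com com  (infixr \<open>;;\<close> 60)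
  | Cond cnd com com
  | While cnd com

text \<open>Source registers hold naturals while the machine subtracts integers. A subtraction that
  would truncate has no execution at all, so both sides agree on every run.\<close>

fun ok :: "op \<Rightarrow> st \<Rightarrow> bool" where
  "ok (IMinus r a b) s \<longleftrightarrow> ir s b \<le> ir s a"
| "ok _ s \<longleftrightarrow> True"

definition tick :: "nat \<Rightarrow> st \<Rightarrow> st" where
  "tick k s = s\<lparr>clk := clk s + k\<rparr>"

text \<open>The increments of \<open>clk\<close> are the lengths of the compiled code. An array
  access costs 5: without integer multiplication its address takes a constant load, two doublings
  and an addition.\<close>

fun ex :: "(nat \<Rightarrow> nat \<Rightarrow> real) \<Rightarrow> op \<Rightarrow> st \<Rightarrow> st" where
  "ex orc (ISet r k) s = s\<lparr>clk := clk s + 1, ir := (ir s)(r := k)\<rparr>"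
| "ex orc (IPlus r a b) s = s\<lparr>clk := clk s + 1, ir := (ir s)(r := ir s a + ir s b)\<rparr>"
| "ex orc (IMinus r a b) s = s\<lparr>clk := clk s + 1, ir := (ir s)(r := ir s a - ir s b)\<rparr>"
| "ex orc (ILd r a k) s = s\<lparr>clk := clk s + 5, ir := (ir s)(r := ia s a (ir s k))\<rparr>"
| "ex orc (ISt a k r) s =
     s\<lparr>clk := clk s + 5, ia := (ia s)(a := (ia s a)(ir s k := ir s r))\<rparr>"
| "ex orc (RSet r k) s = s\<lparr>clk := clk s + 1, rr := (rr s)(r := real k)\<rparr>"
| "ex orc (RPlus r a b) s = s\<lparr>clk := clk s + 1, rr := (rr s)(r := rr s a + rr s b)\<rparr>"
| "ex orc (RMinus r a b) s = s\<lparr>clk := clk s + 1, rr := (rr s)(r := rr s a - rr s b)\<rparr>"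
| "ex orc (RTimes r a b) s = s\<lparr>clk := clk s + 1, rr := (rr s)(r := rr s a * rr s b)\<rparr>"
| "ex orc (ROver r a b) s = s\<lparr>clk := clk s + 1, rr := (rr s)(r := rr s a / rr s b)\<rparr>"
| "ex orc (RLd r a k) s = s\<lparr>clk := clk s + 5, rr := (rr s)(r := ra s a (ir s k))\<rparr>"
| "ex orc (RSt a k r) s =
     s\<lparr>clk := clk s + 5, ra := (ra s)(a := (ra s a)(ir s k := rr s r))\<rparr>"
| "ex orc (ROf r k) s = s\<lparr>clk := clk s + 1, rr := (rr s)(r := real (ir s k))\<rparr>"
| "ex orc (RAvg r i j) s = s\<lparr>clk := clk s + 1, rr := (rr s)(r := orc (ir s i) (ir s j))\<rparr>"

fun holds :: "cnd \<Rightarrow> st \<Rightarrow> bool" where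
  "holds (ILe a b) s \<longleftrightarrow> ir s a \<le> ir s b"
| "holds (RLe a b) s \<longleftrightarrow> rr s a \<le> rr s b"

text \<open>The ticks anticipate the code layout. The else branch follows the conditional jump
  directly and ends with a \<open>Jmp\<close>, hence 2 against 1 for the then branch. A loop pays 2
  per iteration for its test and closing \<open>Jmp\<close>, and 2 on exit for the test and the
  \<open>Jmp\<close> out.\<close>

inductive big :: "(nat \<Rightarrow> nat \<Rightarrow> real) \<Rightarrow> com \<Rightarrow> st \<Rightarrow> st \<Rightarrow> bool" for orc where
  big_op: "ok p s \<Longrightarrow> big orc (Op p) s (ex orc p s)"
| big_skip: "big orc Skip s s"
| big_seq: "big orc c s s' \<Longrightarrow> big orc d s' s'' \<Longrightarrow> big orc (c ;; d) s s''"
| big_then: "holds b s \<Longrightarrow> big orc c (tick (Suc 0) s) s' \<Longrightarrow> big orc (Cond b c d) s s'"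
| big_else: "\<not> holds b s \<Longrightarrow> big orc d (tick 2 s) s' \<Longrightarrow> big orc (Cond b c d) s s'"
| big_done: "\<not> holds b s \<Longrightarrow> big orc (While b c) s (tick 2 s)"
| big_loop: "holds b s \<Longrightarrow> big orc c (tick 2 s) s' \<Longrightarrow> big orc (While b c) s' s'' \<Longrightarrow>
    big orc (While b c) s s''"

inductive_cases big_opE: "big orc (Op p) s s'"
inductive_cases big_skipE: "big orc Skip s s'"
inductive_cases big_seqE: "big orc (c ;; d) s s'"
inductive_cases big_ifE: "big orc (Cond b c d) s s'"

definition wp :: "(nat \<Rightarrow> nat \<Rightarrow> real) \<Rightarrow> com \<Rightarrow> (st \<Rightarrow> bool) \<Rightarrow> st \<Rightarrow> bool" where
  "wp orc c Q s \<longleftrightarrow> (\<exists>s'. big orc c s s' \<and> Q s')"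

lemma wp_op [simp]: "wp orc (Op p) Q s \<longleftrightarrow> ok p s \<and> Q (ex orc p s)"
  unfolding wp_def by (auto intro: big_op elim: big_opE)

lemma wp_skip [simp]: "wp orc Skip Q s \<longleftrightarrow> Q s"
  unfolding wp_def by (auto intro: big_skip elim: big_skipE)

lemma wp_seq [simp]: "wp orc (c ;; d) Q = wp orc c (wp orc d Q)"
  unfolding wp_def by (rule ext) (auto intro: big_seq elim!: big_seqE)

lemma wp_if [simp]:
  "wp orc (Cond b c d) Q s \<longleftrightarrow> (if holds b s then wp orc c Q (tick (Suc 0) s) else wp orc d Q (tick 2 s))"
  unfolding wp_def by (auto intro: big_then big_else elim!: big_ifE)

text \<open>The measure \<open>\<mu>\<close> yields termination. Time bounds enter through the
  invariant, which may mention \<open>clk\<close>; this leaves room for amortized bounds.\<close>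

lemma wp_while:
  fixes \<mu> :: "st \<Rightarrow> nat"
  assumes "I s"
    and "\<And>s. I s \<Longrightarrow> holds b s \<Longrightarrow> wp orc c (\<lambda>s'. I s' \<and> \<mu> s' < \<mu> s) (tick 2 s)"
    and "\<And>s. I s \<Longrightarrow> \<not> holds b s \<Longrightarrow> Q (tick 2 s)"
  shows "wp orc (While b c) Q s"
  using assms(1)
proof (induction s rule: measure_induct_rule[of \<mu>])
  case (less s)
  show ?case
  proof (cases "holds b s")
    case True
    then obtain s' where "big orc c (tick 2 s) s'" "I s'" "\<mu> s' < \<mu> s"
      using assms(2)[OF less.prems] unfolding wp_def by blast
    with less.IH[of s'] True show ?thesis
      unfolding wp_def by (auto intro: big_loop)
  next
    case False
    with assms(3)[OF less.prems] show ?thesis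
      unfolding wp_def by (auto intro: big_done)
  qed
qed

lemma wp_mono: "wp orc c Q s \<Longrightarrow> (\<And>s'. Q s' \<Longrightarrow> Q' s') \<Longrightarrow> wp orc c Q' s"
  unfolding wp_def by blast

section \<open>Compilation with exact step counts\<close>

definition index_code :: "nat \<Rightarrow> ireg \<Rightarrow> instr list" where
  "index_code off k = [IConst 12 (int off), IAdd 13 (icell k) (icell k), IAdd 13 13 13, IAdd 13 13 12]"

fun code :: "op \<Rightarrow> instr list" where
  "code (ISet r k) = [IConst (icell r) (int k)]"
| "code (IPlus r a b) = [IAdd (icell r) (icell a) (icell b)]"
| "code (IMinus r a b) = [ISub (icell r) (icell a) (icell b)]"
| "code (ILd r a k) = index_code (ioff a) k @ [ILoadInd (icell r) 13]"
| "code (ISt a k r) = index_code (ioff a) k @ [IStoreInd 13 (icell r)]"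
| "code (RSet r k) = [RConst (rcell r) (int k)]"
| "code (RPlus r a b) = [RAdd (rcell r) (rcell a) (rcell b)]"
| "code (RMinus r a b) = [RSub (rcell r) (rcell a) (rcell b)]"
| "code (RTimes r a b) = [RMul (rcell r) (rcell a) (rcell b)]"
| "code (ROver r a b) = [RDiv (rcell r) (rcell a) (rcell b)]"
| "code (RLd r a k) = index_code (roff a) k @ [RLoadInd (rcell r) 13]"
| "code (RSt a k r) = index_code (roff a) k @ [RStoreInd 13 (rcell r)]"
| "code (ROf r k) = [OfInt (rcell r) (icell k)]"
| "code (RAvg r i j) = [Avg (rcell r) (icell i) (icell j)]"

fun jump :: "cnd \<Rightarrow> nat \<Rightarrow> instr" where
  "jump (ILe a b) t = IJumpLe (icell a) (icell b) t"
| "jump (RLe a b) t = RJumpLe (rcell a) (rcell b) t"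

fun compile :: "nat \<Rightarrow> com \<Rightarrow> instr list" where
  "compile p (Op o') = code o'"
| "compile p Skip = []"
| "compile p (c ;; d) = compile p c @ compile (p + length (compile p c)) d"
| "compile p (Cond b c d) =
     (let kd = compile (p + 1) d; t = p + 2 + length kd; kc = compile t c
      in [jump b t] @ kd @ [Jmp (t + length kc)] @ kc)"
| "compile p (While b c) =
     (let k = compile (p + 2) c in [jump b (p + 2), Jmp (p + 3 + length k)] @ k @ [Jmp p])"

text \<open>Cells 12 and 13 are left free, so address computations preserve the relation.\<close>

definition models :: "mstate \<Rightarrow> st \<Rightarrow> bool" where
  "models m s \<longleftrightarrow> (\<forall>r. im m (icell r) = int (ir s r)) \<and> (\<forall>a k. im m (4 * k + ioff a) = int (ia s a k))
     \<and> (\<forall>r. rm m (rcell r) = rr s r) \<and> (\<forall>a k. rm m (4 * k + roff a) = ra s a k)"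

definition located :: "instr list \<Rightarrow> nat \<Rightarrow> instr list \<Rightarrow> bool" where
  "located P p is \<longleftrightarrow> (\<exists>us vs. P = us @ is @ vs \<and> length us = p)"

lemma located_append:
  assumes "located P p (is @ js)"
  shows "located P p is" "located P (p + length is) js"
proof -
  from assms obtain us vs where *: "P = us @ (is @ js) @ vs" "length us = p"
    unfolding located_def by blast
  then have "P = us @ is @ (js @ vs)" "P = (us @ is) @ js @ vs" "length (us @ is) = p + length is"
    by auto
  with * show "located P p is" "located P (p + length is) js"
    unfolding located_def by blast+
qed

lemma located_Cons:
  assumes "located P p (i # is)"
  shows "p < length P" "P ! p = i" "located P (Suc p) is"
proof -
  show "p < length P" "P ! p = i" using assms unfolding located_def by (auto simp: nth_append)
  show "located P (Suc p) is" using located_append(2)[of P p "[i]" "is"] assms by simp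
qed

lemma step_located:
  "located P (pc m) (i # is) \<Longrightarrow> i \<noteq> Halt \<Longrightarrow> step orc P m = exec_instr orc i m"
  using located_Cons[of P "pc m" i "is"] by (auto simp: step_def halted_def)

definition plain :: "instr \<Rightarrow> bool" where
  "plain i \<longleftrightarrow> (\<forall>orc m. pc (exec_instr orc i m) = Suc (pc m))"

lemma plain_simps [simp]:
  "plain (IConst a c)" "plain (IAdd a b d)" "plain (ISub a b d)" "plain (ILoadInd a b)"
  "plain (IStoreInd a b)" "plain (RConst a c)" "plain (RAdd a b d)" "plain (RSub a b d)"
  "plain (RMul a b d)" "plain (RDiv a b d)" "plain (RLoadInd a b)" "plain (RStoreInd a b)"
  "plain (OfInt a b)" "plain (Avg a b d)" "\<not> plain Halt"
  by (auto simp: plain_def)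

lemma steps_plain:
  assumes "located P (pc m) is" "\<forall>i\<in>set is. plain i"
  shows "(step orc P ^^ length is) m = fold (exec_instr orc) is m
    \<and> pc (fold (exec_instr orc) is m) = pc m + length is"
  using assms
proof (induction "is" arbitrary: m)
  case Nil
  then show ?case by simp
next
  case (Cons i "is")
  have "step orc P m = exec_instr orc i m"
    using step_located[OF Cons.prems(1)] Cons.prems(2) by (cases "i = Halt") auto
  moreover have p: "pc (exec_instr orc i m) = Suc (pc m)"
    using Cons.prems(2) by (simp add: plain_def)
  moreover have "located P (pc (exec_instr orc i m)) is"
    using located_Cons(3)[OF Cons.prems(1)] p by simp
  ultimately show ?case
    using Cons.IH[of "exec_instr orc i m"] Cons.prems(2) by (simp add: funpow_swap1)
qed

lemma plain_code: "\<forall>i\<in>set (code p). plain i"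
  by (cases p) (auto simp: index_code_def)

lemma clk_ex: "clk (ex orc p s) = clk s + length (code p)"
  by (cases p) (auto simp: index_code_def)

lemma nat_index:
  "nat (4 * int k + int off) = 4 * k + off"
  by linarith

lemma models_fold_code:
  assumes "models m s" "ok p s"
  shows "models (fold (exec_instr orc) (code p) m) (ex orc p s)"
  using assms
  by (cases p) (auto simp: models_def index_code_def nat_index iadr_eq radr_eq of_nat_diff)

lemma models_tick [simp]: "models m (tick k s) = models m s"
  by (simp add: models_def tick_def)

lemma clk_tick [simp]: "clk (tick k s) = clk s + k"
  by (simp add: tick_def)

lemma models_pc [simp]: "models (m\<lparr>pc := p\<rparr>) s = models m s"
  by (simp add: models_def)

lemma exec_jump:
  "models m s \<Longrightarrow>
   exec_instr orc (jump b t) m = m\<lparr>pc := (if holds b s then t else Suc (pc m))\<rparr>"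
  by (cases b) (auto simp: models_def)

lemma jump_neq_Halt [simp]: "jump b t \<noteq> Halt"
  by (cases b) auto

definition reaches :: "(nat \<Rightarrow> nat \<Rightarrow> real) \<Rightarrow> instr list \<Rightarrow> mstate \<Rightarrow> nat \<Rightarrow> mstate \<Rightarrow> bool" where
  "reaches orc P m t m' \<longleftrightarrow> (step orc P ^^ t) m = m'"

lemma reaches_trans:
  "reaches orc P m t m' \<Longrightarrow> reaches orc P m' u m'' \<Longrightarrow> reaches orc P m (t + u) m''"
  unfolding reaches_def by (metis add.commute comp_apply funpow_add)

lemma reaches_step:
  "located P (pc m) (i # is) \<Longrightarrow> i \<noteq> Halt \<Longrightarrow> reaches orc P m 1 (exec_instr orc i m)"
  by (simp add: reaches_def step_located)

lemma reaches_plain: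
  assumes "located P (pc m) is" "\<forall>i\<in>set is. plain i"
  shows "reaches orc P m (length is) (fold (exec_instr orc) is m)"
  using steps_plain[OF assms] by (simp add: reaches_def)

text \<open>Induction on the execution, since a loop body runs repeatedly at one address. The
  equation \<open>clk s' = clk s + t\<close> turns every bound proved on the source into a bound on
  machine steps.\<close>

lemma compile_correct:
  assumes "big orc c s s'" "models m s" "located P (pc m) (compile (pc m) c)"
  shows "\<exists>t m'. reaches orc P m t m' \<and> clk s' = clk s + t \<and> models m' s'
    \<and> pc m' = pc m + length (compile (pc m) c)"
  using assms
proof (induction arbitrary: m rule: big.induct)
  case (big_op p s)
  then show ?case
    using reaches_plain[of P m "code p" orc] plain_code[of p] models_fold_code[of m s p orc]
      steps_plain[of P m "code p" orc] clk_ex[of orc p s]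
    by auto
next
  case (big_skip s)
  then show ?case by (force simp: reaches_def intro: exI[of _ 0])
next
  case (big_seq c s s' d s'')
  from big_seq.prems have l: "located P (pc m) (compile (pc m) c)"
    "located P (pc m + length (compile (pc m) c)) (compile (pc m + length (compile (pc m) c)) d)"
    using located_append by force+
  obtain t m' where 1: "reaches orc P m t m'" "clk s' = clk s + t" "models m' s'"
    "pc m' = pc m + length (compile (pc m) c)"
    using big_seq.IH(1)[OF big_seq.prems(1) l(1)] by blast
  obtain u m'' where 2: "reaches orc P m' u m''" "clk s'' = clk s' + u" "models m'' s''"
    "pc m'' = pc m' + length (compile (pc m') d)"
    using big_seq.IH(2)[OF 1(3)] l(2) 1(4) by metis
  show ?case
    using reaches_trans[OF 1(1) 2(1)] 1 2 by (intro exI[of _ "t + u"] exI[of _ m'']) auto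
next
  case (big_then b s c s' d)
  define kd where "kd = compile (Suc (pc m)) d"
  define q where "q = pc m + 2 + length kd"
  define kc where "kc = compile q c"
  have l: "located P (pc m) (jump b q # (kd @ Jmp (q + length kc) # kc))"
    using big_then.prems(2) by (simp add: Let_def kd_def q_def kc_def)
  let ?m = "m\<lparr>pc := q\<rparr>"
  have 1: "reaches orc P m 1 ?m"
    using reaches_step[OF l, of orc] exec_jump[OF big_then.prems(1)] big_then.hyps(1) by simp
  have "located P (Suc (pc m)) ((kd @ [Jmp (q + length kc)]) @ kc)"
    using located_Cons(3)[OF l] by simp
  from located_append(2)[OF this] have "located P q kc"
    by (simp add: q_def algebra_simps)
  then obtain t m' where 2: "reaches orc P ?m t m'" "clk s' = clk s + 1 + t" "models m' s'"
    "pc m' = q + length kc"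
    using big_then.IH[of ?m] big_then.prems(1) by (auto simp: kc_def)
  show ?case
    using reaches_trans[OF 1 2(1)] 2
    by (intro exI[of _ "1 + t"] exI[of _ m'])
      (simp add: Let_def kd_def[symmetric] q_def[symmetric] kc_def[symmetric], simp add: q_def kc_def kd_def)
next
  case (big_else b s d s' c)
  define kd where "kd = compile (Suc (pc m)) d"
  define q where "q = pc m + 2 + length kd"
  define kc where "kc = compile q c"
  have l: "located P (pc m) (jump b q # (kd @ Jmp (q + length kc) # kc))"
    using big_else.prems(2) by (simp add: Let_def kd_def q_def kc_def)
  let ?m = "m\<lparr>pc := Suc (pc m)\<rparr>"
  have 1: "reaches orc P m 1 ?m"
    using reaches_step[OF l, of orc] exec_jump[OF big_else.prems(1)] big_else.hyps(1) by simp
  have l2: "located P (Suc (pc m)) kd"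
    "located P (Suc (pc m) + length kd) (Jmp (q + length kc) # kc)"
    using located_append[OF located_Cons(3)[OF l]] by auto
  then obtain t m' where 2: "reaches orc P ?m t m'" "clk s' = clk s + 2 + t" "models m' s'"
    "pc m' = Suc (pc m) + length kd"
    using big_else.IH[of ?m] big_else.prems(1) by (auto simp: kd_def)
  have 3: "reaches orc P m' 1 (m'\<lparr>pc := q + length kc\<rparr>)"
    using reaches_step[of P m' "Jmp (q + length kc)" kc orc] l2(2) 2(4) by simp
  show ?case
    using reaches_trans[OF reaches_trans[OF 1 2(1)] 3] 2
    by (intro exI[of _ "1 + t + 1"] exI[of _ "m'\<lparr>pc := q + length kc\<rparr>"])
      (simp add: Let_def kd_def q_def kc_def)
next
  case (big_done b s c)
  define k where "k = compile (pc m + 2) c"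
  have l: "located P (pc m) (jump b (pc m + 2) # Jmp (pc m + 3 + length k) # (k @ [Jmp (pc m)]))"
    using big_done.prems(2) by (simp add: Let_def k_def)
  let ?m = "m\<lparr>pc := Suc (pc m)\<rparr>"
  have 1: "reaches orc P m 1 ?m"
    using reaches_step[OF l, of orc] exec_jump[OF big_done.prems(1)] big_done.hyps(1) by simp
  have 2: "reaches orc P ?m 1 (m\<lparr>pc := pc m + 3 + length k\<rparr>)"
    using reaches_step[of P ?m] located_Cons(3)[OF l] by fastforce
  show ?case
    using reaches_trans[OF 1 2] big_done.prems
    by (intro exI[of _ "1 + 1"] exI[of _ "m\<lparr>pc := pc m + 3 + length k\<rparr>"]) (simp add: Let_def k_def)
next
  case (big_loop b s c s' s'')
  define k where "k = compile (pc m + 2) c"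
  have l: "located P (pc m) (jump b (pc m + 2) # Jmp (pc m + 3 + length k) # (k @ [Jmp (pc m)]))"
    using big_loop.prems(2) by (simp add: Let_def k_def)
  let ?m = "m\<lparr>pc := pc m + 2\<rparr>"
  have 1: "reaches orc P m 1 ?m"
    using reaches_step[OF l, of orc] exec_jump[OF big_loop.prems(1)] big_loop.hyps(1) by simp
  have l2: "located P (pc m + 2) k" "located P (pc m + 2 + length k) [Jmp (pc m)]"
    using located_append[OF located_Cons(3)[OF located_Cons(3)[OF l]]] by auto
  then obtain t m' where 2: "reaches orc P ?m t m'" "clk s' = clk s + 2 + t" "models m' s'"
    "pc m' = pc m + 2 + length k"
    using big_loop.IH(1)[of ?m] big_loop.prems(1) by (auto simp: k_def)
  have 3: "reaches orc P m' 1 (m'\<lparr>pc := pc m\<rparr>)"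
    using reaches_step[of P m' "Jmp (pc m)" "[]" orc] l2(2) 2(4) by simp
  obtain u m'' where 4: "reaches orc P (m'\<lparr>pc := pc m\<rparr>) u m''" "clk s'' = clk s' + u"
    "models m'' s''" "pc m'' = pc m + length (compile (pc m) (While b c))"
    using big_loop.IH(2)[of "m'\<lparr>pc := pc m\<rparr>"] 2(3) big_loop.prems(2) by auto
  show ?case
    using reaches_trans[OF reaches_trans[OF reaches_trans[OF 1 2(1)] 3] 4(1)] 2 4
    by (intro exI[of _ "1 + t + 1 + u"] exI[of _ m'']) simp
qed

section \<open>The block structure\<close>

lemma zsum_split: "i \<le> c \<Longrightarrow> c \<le> d \<Longrightarrow> zsum z i d = zsum z i c + zsum z c d"
  by (simp add: zsum_def sum.atLeastLessThan_concat)

lemma zsum_eq_avg: "i < j \<Longrightarrow> zsum z i j = real (j - i) * avg z i j"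
  by (simp add: avg_def)

text \<open>The average over the union is a weighted mean of the averages of two adjacent parts,
  hence at most the larger one.\<close>

lemma avg_mediant:
  assumes "i < c" "c < d" "avg z i c \<le> avg z c d"
  shows "avg z i d \<le> avg z c d"
proof -
  have "real (d - i) * avg z i d = real (c - i) * avg z i c + real (d - c) * avg z c d"
    using zsum_split[of i c d z] assms by (simp add: zsum_eq_avg)
  also have "\<dots> \<le> real (c - i) * avg z c d + real (d - c) * avg z c d"
    using assms(3) by (simp add: mult_left_mono)
  also have "\<dots> = real (d - i) * avg z c d"
    using assms by (simp add: of_nat_diff algebra_simps)
  finally show ?thesis using assms by simp
qed

lemma jumpf_range:
  assumes "\<forall>k\<le>n. k < f k \<and> f k \<le> n + 1" "c \<le> n + 1"
  shows "c \<le> jumpf z n f i m c \<and> jumpf z n f i m c \<le> n + 1"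
  using assms(2)
proof (induction m arbitrary: c)
  case (Suc m)
  have "c \<noteq> n + 1 \<Longrightarrow> c < f c \<and> f c \<le> n + 1"
    using assms(1) Suc.prems by auto
  with Suc show ?case by force
qed simp

text \<open>A scan started at i reads the table only to the right of i, so what the downward pass
  writes at i and below cannot affect it.\<close>

lemma jumpf_cong:
  assumes "\<forall>k>i. f k = g k \<and> i < g k" "i < c"
  shows "jumpf z n f i m c = jumpf z n g i m c"
  using assms(2)
proof (induction m arbitrary: c)
  case (Suc m)
  with assms(1) show ?case by auto
qed simp

text \<open>Each entry is written once and later rounds write only further left, so the final table
  satisfies the recursion with itself as lookup table. The rest of the proof works from this
  fixed-point equation.\<close>

lemma barr_range_and_rec:
  fixes z :: "nat \<Rightarrow> real"
  assumes "1 \<le> m" "m \<le> n"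
  defines "f \<equiv> (\<lambda>m. foldl (bstep z n) (\<lambda>_. n + 1) (rev [m..<n]))"
  shows "(\<forall>k\<le>n. k < f m k \<and> f m k \<le> n + 1) \<and> (\<forall>k>n. f m k = n + 1)
    \<and> (\<forall>k. m \<le> k \<longrightarrow> k \<le> n \<longrightarrow> f m k = jumpf z n (f m) k (n + 1) (k + 1))"
  using assms(2,1)
proof (induction m rule: inc_induct)
  case base
  show ?case by (auto simp: f_def)
next
  case (step m)
  let ?j = "jumpf z n (f (Suc m)) m (n + 1) (m + 1)"
  have "f m = bstep z n (f (Suc m)) m"
    using step.hyps by (simp add: f_def upt_conv_Cons)
  then have fm: "f m m = ?j" and fk: "\<And>k. k \<noteq> m \<Longrightarrow> f m k = f (Suc m) k"
    by (simp_all add: bstep_def del: jumpf.simps)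
  have IH: "\<forall>k\<le>n. k < f (Suc m) k \<and> f (Suc m) k \<le> n + 1" "\<forall>k>n. f (Suc m) k = n + 1"
    "\<And>k. Suc m \<le> k \<Longrightarrow> k \<le> n \<Longrightarrow> f (Suc m) k = jumpf z n (f (Suc m)) k (n + 1) (k + 1)"
    using step.IH[OF le_Suc_eq[THEN iffD2, OF disjI1, OF step.prems]] by blast+
  have r: "m + 1 \<le> ?j \<and> ?j \<le> n + 1"
    using step.hyps by (intro jumpf_range[OF IH(1)]) simp
  have 1: "k < f m k \<and> f m k \<le> n + 1" if "k \<le> n" for k
    using IH(1) r fm fk that by (cases "k = m") (auto simp del: jumpf.simps)
  have 2: "f m k = n + 1" if "n < k" for k
    using IH(2) fk[of k] that step.hyps by auto
  have 3: "f m k = jumpf z n (f m) k (n + 1) (k + 1)" if "m \<le> k" "k \<le> n" for k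
  proof -
    have gt: "k < f m l" if "k < l" for l
      using 1[of l] 2[of l] \<open>k \<le> n\<close> that by linarith
    have "\<forall>l>k. f (Suc m) l = f m l \<and> k < f m l"
      using that gt fk by auto
    then have "jumpf z n (f (Suc m)) k (n + 1) (k + 1) = jumpf z n (f m) k (n + 1) (k + 1)"
      by (intro jumpf_cong) auto
    with IH(3)[of k] fm fk[of k] that show ?thesis
      by (cases "k = m") (auto simp del: jumpf.simps)
  qed
  from 1 2 3 show ?case by blast
qed

locale problem =
  fixes n :: nat and q z :: "nat \<Rightarrow> real" and K :: real
  assumes inst: "instance_P n q z K"
begin

abbreviation b :: "nat \<Rightarrow> nat" where "b \<equiv> barr z n"
abbreviation y :: "nat \<Rightarrow> real" where "y \<equiv> yv z n"

lemma n_pos: "1 \<le> n" and K_pos: "0 < K"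
  and q_pos: "1 \<le> i \<Longrightarrow> i \<le> n \<Longrightarrow> 0 < q i"
  and z_pos: "1 \<le> i \<Longrightarrow> i \<le> n \<Longrightarrow> 0 < z i"
  and q_mono: "1 \<le> i \<Longrightarrow> i \<le> j \<Longrightarrow> j \<le> n \<Longrightarrow> q i \<le> q j"
  using inst by (auto simp: instance_P_def)

lemma b_bounds: "k \<le> n \<Longrightarrow> k < b k" "k \<le> n \<Longrightarrow> b k \<le> n + 1"
  using barr_range_and_rec[of 1 n z] n_pos by (auto simp: barr_def)

lemma b_rec: "1 \<le> k \<Longrightarrow> k \<le> n \<Longrightarrow> b k = jumpf z n b k (n + 1) (k + 1)"
  using barr_range_and_rec[of 1 n z] n_pos by (auto simp: barr_def)

lemma avg_pos:
  assumes "1 \<le> i" "i < j" "j \<le> n + 1"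
  shows "0 < avg z i j"
  unfolding avg_def zsum_def using assms z_pos by (intro divide_pos_pos sum_pos) auto

lemma y_pos: "1 \<le> i \<Longrightarrow> i \<le> n \<Longrightarrow> 0 < y i"
  unfolding yv_def using avg_pos b_bounds by simp

text \<open>A block average is at most the block sum, which is at most the total of all
  \<open>z\<close>. One oracle call and a multiplication by n produce that total, so the machine can
  compute a key above every \<open>y\<close>.\<close>

lemma y_less_big:
  assumes "1 \<le> i" "i \<le> n"
  shows "y i < avg z 1 (n + 1) * real n + 1"
proof -
  have "y i \<le> real (b i - i) * y i"
    using y_pos[OF assms] b_bounds(1)[OF assms(2)] by (simp add: mult_le_cancel_right1)
  also have "\<dots> = zsum z i (b i)"
    using zsum_eq_avg[of i "b i" z] b_bounds(1)[OF assms(2)] by (simp add: yv_def)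
  also have "\<dots> \<le> zsum z 1 (n + 1)"
    unfolding zsum_def using assms b_bounds(2)[OF assms(2)] z_pos
    by (intro sum_mono2) (auto intro!: less_imp_le)
  also have "\<dots> = avg z 1 (n + 1) * real n"
    using zsum_eq_avg[of 1 "n + 1" z] n_pos by simp
  finally show ?thesis by simp
qed

text \<open>The strict inequality \<open>y (b i) < y i\<close> is the failed test that ended the
  scan. A later scan that jumps over the block of i arrives at \<open>b i\<close> and must know that
  \<open>y\<close> there lies below every \<open>y\<close> inside.\<close>

definition nested :: "nat \<Rightarrow> bool" where
  "nested i \<longleftrightarrow> (\<forall>k. i < k \<and> k < b i \<longrightarrow> b k \<le> b i \<and> y i \<le> y k) \<and> (b i \<le> n \<longrightarrow> y (b i) < y i)"

text \<open>Invariant of the inner while-loop of index i with pointer c. The bound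
  \<open>n + 2 \<le> m + c\<close> says that the fuel suffices: a jump costs one unit and raises c
  by at least 1, and one unit is left as long as \<open>c \<le> n + 1\<close>.\<close>

definition scan :: "nat \<Rightarrow> nat \<Rightarrow> bool" where
  "scan i c \<longleftrightarrow> i < c \<and> c \<le> n + 1 \<and> (\<exists>m. n + 2 \<le> m + c \<and> jumpf z n b i m c = b i)
     \<and> (\<forall>k. i < k \<and> k < c \<longrightarrow> b k \<le> c \<and> avg z i c \<le> y k \<and> (c \<le> n \<longrightarrow> y c \<le> y k))"

lemma scan_start: "1 \<le> i \<Longrightarrow> i \<le> n \<Longrightarrow> scan i (i + 1)"
  using b_rec[of i] by (auto simp: scan_def intro!: exI[of _ "n + 1"])

text \<open>By the mediant inequality the enlarged average is at most \<open>y c\<close>, and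
  \<open>y c\<close> is minimal in the enlarged range: below c by \<open>scan\<close>, inside the
  block of c by \<open>nested c\<close>.\<close>

lemma scan_jump:
  assumes "scan i c" "c \<le> n" "avg z i c \<le> y c" "nested c"
  shows "scan i (b c)"
proof -
  from assms(1) obtain m where m: "n + 2 \<le> m + c" "jumpf z n b i m c = b i" "i < c"
    and k: "\<And>k. i < k \<Longrightarrow> k < c \<Longrightarrow> b k \<le> c \<and> avg z i c \<le> y k \<and> y c \<le> y k"
    using assms(2) unfolding scan_def by blast
  from m(1) assms(2) obtain m' where m': "m = Suc m'" by (cases m) auto
  have bc: "c < b c" "b c \<le> n + 1" using b_bounds assms(2) by auto
  have "jumpf z n b i m' (b c) = b i"
    using m(2) assms(2,3) by (simp add: m' yv_def)
  moreover have "n + 2 \<le> m' + b c" using m(1) m' bc by simp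
  moreover have le: "avg z i (b c) \<le> y c"
    using avg_mediant[of i c "b c" z] m(3) bc(1) assms(3) by (simp add: yv_def)
  moreover have "b j \<le> b c \<and> y c \<le> y j" if "i < j" "j < b c" for j
  proof -
    consider "j < c" | "j = c" | "c < j" by linarith
    then show ?thesis
      using k[of j] assms(4) that bc by cases (auto simp: nested_def)
  qed
  moreover have "b c \<le> n \<Longrightarrow> y (b c) < y c" using assms(4) by (simp add: nested_def)
  ultimately show ?thesis
    using m(3) bc unfolding scan_def by force
qed

lemma scan_stop:
  assumes "scan i c" "\<not> (c \<le> n \<and> avg z i c \<le> y c)"
  shows "b i = c" "nested i"
proof -
  from assms(1) obtain m where m: "n + 2 \<le> m + c" "jumpf z n b i m c = b i" "i < c" "c \<le> n + 1"
    and k: "\<And>k. i < k \<Longrightarrow> k < c \<Longrightarrow> b k \<le> c \<and> avg z i c \<le> y k"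
    unfolding scan_def by blast
  from m(1,4) obtain m' where "m = Suc m'" by (cases m) auto
  with m(2,4) assms(2) show *: "b i = c" by (auto simp: yv_def split: if_splits)
  show "nested i"
    using k assms(2) by (auto simp: nested_def * yv_def[of z n i])
qed

text \<open>The outer induction runs downwards on i, since a scan jumps only over blocks that start
  further right; the inner one follows the scan of i to its end.\<close>

lemma nested: "1 \<le> i \<Longrightarrow> i \<le> n \<Longrightarrow> nested i"
proof (induction "n - i" arbitrary: i rule: less_induct)
  case less
  have "nested i" if "scan i c" for c
    using that
  proof (induction "n + 1 - c" arbitrary: c rule: less_induct)
    case (less c)
    have "i < c" using less.prems by (simp add: scan_def)
    show ?case
    proof (cases "c \<le> n \<and> avg z i c \<le> y c")
      case True
      then have "nested c"
        using \<open>i < c\<close> less.prems by (intro \<open>\<And>j. n - j < n - i \<Longrightarrow> 1 \<le> j \<Longrightarrow> j \<le> n \<Longrightarrow> nested j\<close>) auto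
      then have "scan i (b c)" using scan_jump less.prems True by simp
      moreover have "n + 1 - b c < n + 1 - c" using b_bounds[of c] True by auto
      ultimately show ?thesis using less.hyps by blast
    qed (use scan_stop less.prems in blast)
  qed
  then show ?case using scan_start less.prems by blast
qed

lemma b_laminar: "1 \<le> i \<Longrightarrow> i < k \<Longrightarrow> k < b i \<Longrightarrow> i \<le> n \<Longrightarrow> b k \<le> b i"
  and y_le_inner: "1 \<le> i \<Longrightarrow> i < k \<Longrightarrow> k < b i \<Longrightarrow> i \<le> n \<Longrightarrow> y i \<le> y k"
  using nested[of i] by (auto simp: nested_def)

section \<open>The parent relation\<close>

text \<open>\<open>par 1 k\<close> is the parent of \<open>k\<close>, or \<open>0\<close> for an outermost block; \<open>par (i + 1)\<close> is the table of
  parents known when the first phase reaches \<open>i\<close>.\<close>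
definition par :: "nat \<Rightarrow> nat \<Rightarrow> nat" where
  "par i k = Max (insert 0 {j. i \<le> j \<and> j < k \<and> k < b j})"

lemma par_cases:
  obtains "par i k = 0" "\<And>j. i \<le> j \<Longrightarrow> j < k \<Longrightarrow> 0 < j \<Longrightarrow> b j \<le> k"
  | "i \<le> par i k" "par i k < k" "k < b (par i k)" "\<And>j. i \<le> j \<Longrightarrow> j < k \<Longrightarrow> k < b j \<Longrightarrow> j \<le> par i k"
proof -
  let ?A = "insert 0 {j. i \<le> j \<and> j < k \<and> k < b j}"
  have fin: "finite ?A" by (auto intro: finite_subset[of _ "{..k}"])
  then have in': "par i k \<in> ?A" unfolding par_def by (intro Max_in) auto
  have ge: "j \<le> par i k" if "i \<le> j" "j < k" "k < b j" for j
    unfolding par_def using fin that by (intro Max_ge) auto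
  show thesis
  \<comment> \<open>For i = 0 the value 0 may be a true element of the set instead of the
    default.\<close>
  proof (cases "par i k = 0 \<and> \<not> (i = 0 \<and> 0 < k \<and> k < b 0)")
    case True
    have "b j \<le> k" if "i \<le> j" "j < k" "0 < j" for j
      using ge[OF that(1,2)] True that(3) by force
    with True that(1) show thesis by blast
  next
    case False
    with in' ge that(2) show thesis by auto
  qed
qed

lemma par_less: "0 < k \<Longrightarrow> par i k < k"
  by (rule par_cases[of i k]) auto

text \<open>Entries of \<open>par (i + 1)\<close> are 0 or exceed i, so the \<open>max\<close>
  writes i exactly where no parent has been found yet: i adopts the parentless indices inside its
  block.\<close>

lemma par_step:
  assumes "1 \<le> i"
  shows "par i k = (if i < k \<and> k < b i then max (par (i + 1) k) i else par (i + 1) k)"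
proof -
  have *: "{j. i \<le> j \<and> j < k \<and> k < b j} =
    (if i < k \<and> k < b i then insert i {j. i + 1 \<le> j \<and> j < k \<and> k < b j}
     else {j. i + 1 \<le> j \<and> j < k \<and> k < b j})"
    by (auto simp: Suc_le_eq le_less)
  have "finite {j. i + 1 \<le> j \<and> j < k \<and> k < b j}"
    by (auto intro: finite_subset[of _ "{..k}"])
  then show ?thesis
    unfolding par_def * by (auto simp: insert_commute[of 0 i] max.commute)
qed

lemma par_beyond: "n \<le> i \<Longrightarrow> k \<le> n \<Longrightarrow> par i k = 0"
  by (rule par_cases[of i k]) auto

text \<open>Blocks that start strictly between i and c end by c. Hence recording i as the parent of
  c turns a 0 into a positive entry, and no entry is paid for twice.\<close>

lemma par_scan_here:
  assumes "scan i c"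
  shows "par (i + 1) c = 0"
proof (rule par_cases[of "i + 1" c])
  assume *: "i + 1 \<le> par (i + 1) c" "par (i + 1) c < c" "c < b (par (i + 1) c)"
  then have "b (par (i + 1) c) \<le> c" using assms unfolding scan_def by simp
  with * show ?thesis by simp
qed

text \<open>The indices skipped by a jump over the block of c have c as a candidate, hence a parent
  at or beyond c already. One table write per jump therefore suffices.\<close>

lemma par_scan_inside: "1 \<le> i \<Longrightarrow> i < c \<Longrightarrow> c < k \<Longrightarrow> k < b c \<Longrightarrow> i < par (i + 1) k"
proof (rule par_cases[of "i + 1" k])
  assume "1 \<le> i" "i < c" "c < k" "k < b c" "\<And>j. i + 1 \<le> j \<Longrightarrow> j < k \<Longrightarrow> 0 < j \<Longrightarrow> b j \<le> k"
  from this(1-4) this(5)[of c] show ?thesis by simp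
qed simp

text \<open>A block around k other than its own is a candidate for the parent, so it starts at or
  before the parent and contains it. Conversely, a block around the parent contains the whole block
  of the parent by laminarity.\<close>

lemma par_block_iff:
  assumes "1 \<le> i" "i \<le> n" "1 \<le> k" "k \<le> n" "k \<noteq> i"
  shows "i \<le> k \<and> k < b i \<longleftrightarrow> i \<le> par 1 k \<and> par 1 k < b i"
proof (rule par_cases[of 1 k])
  assume "par 1 k = 0" "\<And>j. 1 \<le> j \<Longrightarrow> j < k \<Longrightarrow> 0 < j \<Longrightarrow> b j \<le> k"
  with assms show ?thesis by (metis le_neq_implies_less not_le not_one_le_zero zero_less_one less_le_trans)
next
  assume p: "1 \<le> par 1 k" "par 1 k < k" "k < b (par 1 k)"
    "\<And>j. 1 \<le> j \<Longrightarrow> j < k \<Longrightarrow> k < b j \<Longrightarrow> j \<le> par 1 k"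
  show ?thesis
  proof
    assume "i \<le> k \<and> k < b i"
    with p assms show "i \<le> par 1 k \<and> par 1 k < b i" by auto
  next
    assume *: "i \<le> par 1 k \<and> par 1 k < b i"
    then have "b (par 1 k) \<le> b i"
      using b_laminar[of i "par 1 k"] assms by (cases "i = par 1 k") auto
    with * p show "i \<le> k \<and> k < b i" by auto
  qed
qed

section \<open>The greedy loop\<close>

definition before :: "nat \<Rightarrow> nat \<Rightarrow> bool" where
  "before i j \<longleftrightarrow> y i < y j \<or> y i = y j \<and> i < j"

definition pick :: "nat set \<Rightarrow> nat" where
  "pick S = (LEAST i. i \<in> {1..n} - S \<and> (\<forall>j\<in>{1..n} - S. y i \<le> y j))"

lemma pick_eq:
  assumes "i \<in> {1..n} - S" "\<And>j. j \<in> {1..n} - S \<Longrightarrow> j \<noteq> i \<Longrightarrow> before i j"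
  shows "pick S = i"
  unfolding pick_def
proof (rule Least_equality)
  show "i \<in> {1..n} - S \<and> (\<forall>j\<in>{1..n} - S. y i \<le> y j)"
    using assms unfolding before_def by (metis order.refl less_imp_le)
  show "i \<le> j" if "j \<in> {1..n} - S \<and> (\<forall>k\<in>{1..n} - S. y j \<le> y k)" for j
    using assms(2)[of j] that assms(1) unfolding before_def
    by (cases "j = i") (auto simp: not_less[symmetric])
qed

lemma pick_props:
  assumes "{1..n} - S \<noteq> {}"
  shows "pick S \<in> {1..n} - S" "j \<in> {1..n} - S \<Longrightarrow> j \<noteq> pick S \<Longrightarrow> before (pick S) j"
proof -
  let ?P = "\<lambda>i. i \<in> {1..n} - S \<and> (\<forall>j\<in>{1..n} - S. y i \<le> y j)"
  have "finite ({1..n} - S)" by simp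
  then obtain i where "?P i"
    using ex_min_if_finite[of "y ` ({1..n} - S)"] assms by (fastforce simp: not_less)
  then have P: "?P (pick S)" unfolding pick_def by (rule LeastI)
  then show "pick S \<in> {1..n} - S" by blast
  show "before (pick S) j" if j: "j \<in> {1..n} - S" "j \<noteq> pick S"
  proof (cases "y (pick S) = y j")
    case True
    with P j have "?P j" by auto
    then have "pick S \<le> j" unfolding pick_def by (rule Least_le)
    with True j show ?thesis by (simp add: before_def)
  next
    case False
    with P j show ?thesis by (auto simp: before_def le_less)
  qed
qed

definition incr :: "nat set \<times> (nat \<Rightarrow> real) \<times> real \<Rightarrow> real" where
  "incr = (\<lambda>(S, x, B). min (B / (real (b (pick S) - pick S) * y (pick S))) (q (pick S) - x (pick S)))"

definition fstep :: "nat set \<times> (nat \<Rightarrow> real) \<times> real \<Rightarrow> nat set \<times> (nat \<Rightarrow> real) \<times> real" where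
  "fstep = (\<lambda>(S, x, B). (insert (pick S) S,
     (\<lambda>k. if pick S \<le> k \<and> k < b (pick S) then x k + incr (S, x, B) else x k),
     B - incr (S, x, B) * real (b (pick S) - pick S) * y (pick S)))"

lemma gstep_fstep:
  "gstep q z n (S, x, B) = (if B > 0 \<and> {1..n} - S \<noteq> {} then fstep (S, x, B) else (S, x, B))"
  by (simp only: gstep_def fstep_def incr_def pick_def Let_def prod.case cong: if_cong)

text \<open>The greedy loop without the test for an exhausted budget: all \<open>n\<close> rounds are carried out,
  and those with an empty budget have increment \<open>0\<close>.\<close>
primrec run :: "nat \<Rightarrow> nat set \<times> (nat \<Rightarrow> real) \<times> real" where
  "run 0 = ({0, n + 1}, (\<lambda>_. 0), K)"
| "run (Suc m) = fstep (run m)"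

text \<open>The second clause makes the settled indices an initial segment of the order
  \<open>before\<close>. The third is the parent property; index 0, with \<open>x 0 = 0\<close>,
  stands in for the parent of an outermost block.\<close>

definition run_inv :: "nat \<Rightarrow> nat set \<times> (nat \<Rightarrow> real) \<times> real \<Rightarrow> bool" where
  "run_inv m = (\<lambda>(S, x, B). card ({1..n} - S) = n - m
     \<and> (\<forall>k\<in>{1..n} \<inter> S. \<forall>j\<in>{1..n} - S. before k j)
     \<and> (\<forall>k\<in>{1..n} - S. x k = x (par 1 k)) \<and> (\<forall>k\<in>{1..n}. x k \<le> q k) \<and> x 0 = 0 \<and> 0 \<le> B)"

lemma run_inv_nonempty:
  assumes "run_inv m (S, x, B)" "m < n"
  shows "{1..n} - S \<noteq> {}"
proof
  assume e: "{1..n} - S = {}"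
  have "card ({1..n} - S) = n - m" using assms(1) by (simp add: run_inv_def)
  with assms(2) show False by (simp only: e) simp
qed

text \<open>An index inside the block of i has at least the same \<open>y\<close> and is larger, so
  i precedes it in the pick order. Settled values are therefore final.\<close>

lemma pick_block_done:
  assumes "run_inv m (S, x, B)" "{1..n} - S \<noteq> {}" "k \<in> {1..n} \<inter> S"
  shows "\<not> (pick S \<le> k \<and> k < b (pick S))"
proof
  assume *: "pick S \<le> k \<and> k < b (pick S)"
  have i: "pick S \<in> {1..n} - S" using pick_props(1)[OF assms(2)] .
  then have "pick S < k" using * assms(3) by (cases "pick S = k") auto
  then have "y (pick S) \<le> y k" using * i y_le_inner by auto
  moreover have "before k (pick S)" using assms i unfolding run_inv_def by blast
  ultimately show False using \<open>pick S < k\<close> by (auto simp: before_def)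
qed

lemma run_inv_fstep:
  assumes inv: "run_inv m (S, x, B)" and "m < n"
  shows "run_inv (Suc m) (fstep (S, x, B))"
proof -
  define i d where "i = pick S" and "d = incr (S, x, B)"
  define x' where "x' = (\<lambda>k. if i \<le> k \<and> k < b i then x k + d else x k)"
  have I: "card ({1..n} - S) = n - m" "\<And>k j. k \<in> {1..n} \<inter> S \<Longrightarrow> j \<in> {1..n} - S \<Longrightarrow> before k j"
    "\<And>k. k \<in> {1..n} - S \<Longrightarrow> x k = x (par 1 k)" "\<And>k. k \<in> {1..n} \<Longrightarrow> x k \<le> q k" "x 0 = 0"
    using inv unfolding run_inv_def prod.case by blast+
  have ne: "{1..n} - S \<noteq> {}"
    using run_inv_nonempty[OF assms] .
  have i: "i \<in> {1..n} - S" "\<And>j. j \<in> {1..n} - S \<Longrightarrow> j \<noteq> i \<Longrightarrow> before i j"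
    using pick_props[OF ne] by (auto simp: i_def)
  have w: "0 < real (b i - i) * y i"
    using i(1) y_pos[of i] b_bounds[of i] by simp
  have d: "d \<le> B / (real (b i - i) * y i)" "d \<le> q i - x i"
    by (simp_all add: d_def incr_def i_def)
  have par: "x' k = x' (par 1 k)" if "k \<in> {1..n} - insert i S" for k
    using par_block_iff[of i k] i(1) that I(3)[of k] by (simp add: x'_def)
  have le: "x' k \<le> q k" if "k \<in> {1..n}" for k
    using that
  proof (induction k rule: less_induct)
    case (less k)
    consider "k = i" | "k \<in> {1..n} \<inter> S" "k \<noteq> i" | "k \<in> {1..n} - insert i S"
      using less.prems by blast
    then show ?case
    proof cases
      case 1
      with d(2) i(1) b_bounds[of i] show ?thesis by (simp add: x'_def)
    next
      case 2
      then show ?thesis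
        using pick_block_done[OF inv ne, of k] I(4)[OF less.prems]
        unfolding x'_def i_def by auto
    next
      case 3
      \<comment> \<open>The parent lies to the left, so the induction hypothesis bounds its value by
        its own \<open>q\<close>, and monotonicity of \<open>q\<close> does the rest.\<close>
      have "x' (par 1 k) \<le> q k"
      proof (cases "par 1 k = 0")
        case True
        with i(1) less.prems I(5) show ?thesis
          using q_pos[of k] by (simp add: x'_def)
      next
        case False
        with less.prems par_less[of k 1] have "x' (par 1 k) \<le> q (par 1 k)" by (intro less.IH) auto
        also have "\<dots> \<le> q k" using False less.prems par_less[of k 1] by (intro q_mono) auto
        finally show ?thesis .
      qed
      with par[OF 3] show ?thesis by simp
    qed
  qed
  have "{1..n} - insert i S = ({1..n} - S) - {i}" by blast
  then have "card ({1..n} - insert i S) = n - Suc m"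
    using i(1) I(1) by simp
  moreover have "before k j" if "k \<in> {1..n} \<inter> insert i S" "j \<in> {1..n} - insert i S" for k j
    using I(2)[of k j] i(2)[of j] that by auto
  moreover have "x' 0 = 0" using i(1) I(5) by (simp add: x'_def)
  moreover have "0 \<le> B - d * real (b i - i) * y i"
    using pos_le_divide_eq[OF w, of d B] d(1) by (simp only: mult.assoc) simp
  moreover have "fstep (S, x, B) = (insert i S, x', B - d * real (b i - i) * y i)"
    unfolding fstep_def x'_def i_def d_def by simp
  ultimately show ?thesis using par le unfolding run_inv_def by simp
qed

lemma run_inv: "m \<le> n \<Longrightarrow> run_inv m (run m)"
proof (induction m)
  case 0
  have "{1..n} - {0, Suc n} = {1..n}" "{1..n} \<inter> {0, Suc n} = {}" by auto
  then show ?case using K_pos q_pos by (auto simp: run_inv_def less_imp_le)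
next
  case (Suc m)
  then show ?case using run_inv_fstep[of m] by (cases "run m") auto
qed

lemma fstep_exhausted:
  assumes "run_inv m (S, x, 0)" "m < n"
  shows "\<exists>T. fstep (S, x, 0) = (T, x, 0)"
proof -
  have ne: "{1..n} - S \<noteq> {}"
    using run_inv_nonempty[OF assms] .
  then have "x (pick S) \<le> q (pick S)"
    using pick_props(1)[OF ne] assms(1) unfolding run_inv_def prod.case by blast
  then have "incr (S, x, 0) = 0" by (simp add: incr_def)
  then show ?thesis by (auto simp: fstep_def)
qed

text \<open>Once the budget is gone the original loop freezes its set of settled indices while
  \<open>run\<close> keeps enlarging its own; only x and the zero budget remain comparable.\<close>

lemma gstep_run:
  "m \<le> n \<Longrightarrow> (gstep q z n ^^ m) (run 0) = run m \<or>
    (\<exists>S T x. (gstep q z n ^^ m) (run 0) = (S, x, 0) \<and> run m = (T, x, 0))"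
proof (induction m)
  case (Suc m)
  obtain S x B where r: "run m = (S, x, B)" by (cases "run m") auto
  have inv: "run_inv m (S, x, B)" using run_inv[of m] Suc.prems r by simp
  have ne: "{1..n} - S \<noteq> {}" using run_inv_nonempty[OF inv] Suc.prems by simp
  have "0 \<le> B" using inv by (simp add: run_inv_def)
  moreover have "(gstep q z n ^^ m) (run 0) = run m \<or> (\<exists>U. (gstep q z n ^^ m) (run 0) = (U, x, 0) \<and> B = 0)"
    using Suc.IH Suc.prems r by (auto simp del: run.simps)
  ultimately consider "(gstep q z n ^^ m) (run 0) = run m" "0 < B"
    | U where "(gstep q z n ^^ m) (run 0) = (U, x, 0)" "B = 0"
    using r by (cases "B = 0") (auto simp del: run.simps)
  then show ?case
  proof cases
    case 1
    then show ?thesis using ne r by (simp add: gstep_fstep del: run.simps(1))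
  next
    case 2
    then show ?thesis
      using fstep_exhausted[of m S x] inv Suc.prems r by (auto simp: gstep_fstep simp del: run.simps(1))
  qed
qed simp

lemma alg2_eq_run: "alg2 q z n K = fst (snd (run n))"
  using gstep_run[of n] by (auto simp: alg2_def)

end

section \<open>Tournament trees\<close>

definition better :: "(nat \<Rightarrow> real) \<Rightarrow> nat \<Rightarrow> nat \<Rightarrow> nat" where
  "better key i j = (if key i < key j \<or> key i = key j \<and> i \<le> j then i else j)"

definition node_ok :: "(nat \<Rightarrow> real) \<Rightarrow> (nat \<Rightarrow> nat) \<Rightarrow> nat \<Rightarrow> bool" where
  "node_ok key T v \<longleftrightarrow> T v = better key (T (2 * v)) (T (2 * v + 1))"

text \<open>Strict ancestors in heap numbering with root 1. Node 0 counts as an ancestor of the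
  root, so the tree lemmas speak of nodes with \<open>1 \<le> u\<close>.\<close>

inductive above :: "nat \<Rightarrow> nat \<Rightarrow> bool" where
  "above (v div 2) v"
| "above u (v div 2) \<Longrightarrow> above u v"

lemma above_half: "above w l \<Longrightarrow> above (w div 2) l"
  by (induction rule: above.induct) (auto intro: above.intros)

lemma above_cases: "above u v \<longleftrightarrow> u = v div 2 \<or> above u (v div 2)"
  by (auto intro: above.intros elim: above.cases)

lemma above_one: "above u v \<Longrightarrow> v \<le> 1 \<Longrightarrow> u = 0"
  by (induction rule: above.induct) auto

lemma tree_range:
  assumes "\<And>k. 1 \<le> k \<Longrightarrow> k \<le> n \<Longrightarrow> T (n + k - 1) = k"
    and "\<And>u. 1 \<le> u \<Longrightarrow> u < n \<Longrightarrow> node_ok key T u"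
    and "1 \<le> v" "v < 2 * n"
  shows "1 \<le> T v \<and> T v \<le> n"
  using assms(3,4)
proof (induction "2 * n - v" arbitrary: v rule: less_induct)
  case less
  show ?case
  proof (cases "v < n")
    case True
    then have "T v = T (2 * v) \<or> T v = T (2 * v + 1)"
      using assms(2)[of v] less.prems by (auto simp: node_ok_def better_def)
    then show ?thesis using less.hyps[of "2 * v"] less.hyps[of "2 * v + 1"] less.prems True by auto
  next
    case False
    then show ?thesis using assms(1)[of "v + 1 - n"] less.prems by auto
  qed
qed

lemma tree_path:
  assumes "\<And>k. 1 \<le> k \<Longrightarrow> k \<le> n \<Longrightarrow> T (n + k - 1) = k"
    and "\<And>u. 1 \<le> u \<Longrightarrow> u < n \<Longrightarrow> node_ok key T u"
    and "1 \<le> v" "v < 2 * n"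
  shows "v = n + T v - 1 \<or> above v (n + T v - 1)"
  using assms(3,4)
proof (induction "2 * n - v" arbitrary: v rule: less_induct)
  case less
  show ?case
  proof (cases "v < n")
    case True
    then obtain w where w: "T v = T w" "w div 2 = v" "v < w" "w < 2 * n"
      using assms(2)[of v] less.prems
      by (cases "T v = T (2 * v)") (auto simp: node_ok_def better_def split: if_splits)
    then have "w = n + T v - 1 \<or> above w (n + T v - 1)"
      using less.hyps[of w] less.prems by auto
    then show ?thesis using above_half[of w] w(2) above.intros(1)[of w] by auto
  next
    case False
    then show ?thesis using assms(1)[of "v + 1 - n"] less.prems by auto
  qed
qed

lemma tree_root:
  assumes "\<And>k. 1 \<le> k \<Longrightarrow> k \<le> n \<Longrightarrow> T (n + k - 1) = k"
    and "\<And>u. 1 \<le> u \<Longrightarrow> u < n \<Longrightarrow> node_ok key T u"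
    and "1 \<le> k" "k \<le> n"
  shows "key (T 1) < key k \<or> key (T 1) = key k \<and> T 1 \<le> k"
proof -
  have "key (T 1) < key (T v) \<or> key (T 1) = key (T v) \<and> T 1 \<le> T v" if "1 \<le> v" "v < 2 * n" for v
    using that
  proof (induction v rule: less_induct)
    case (less v)
    show ?case
    proof (cases "v = 1")
      case False
      define u where "u = v div 2"
      have u: "1 \<le> u" "u < v" "u < n" "v = 2 * u \<or> v = 2 * u + 1"
        using False less.prems unfolding u_def by auto
      have "key (T u) < key (T v) \<or> key (T u) = key (T v) \<and> T u \<le> T v"
        using assms(2)[OF u(1,3)] u(4) by (auto simp: node_ok_def better_def split: if_splits)
      moreover have "key (T 1) < key (T u) \<or> key (T 1) = key (T u) \<and> T 1 \<le> T u"
        using less.IH[of u] u less.prems by auto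
      ultimately show ?thesis by auto
    qed simp
  qed
  from this[of "n + k - 1"] show ?thesis using assms(1)[OF assms(3,4)] assms(3,4) by auto
qed

text \<open>By \<open>tree_path\<close>, a node off the path from the leaf of a to the root has no
  child won by a, so its match does not see the new key.\<close>

lemma tree_key_update:
  assumes "\<And>k. 1 \<le> k \<Longrightarrow> k \<le> n \<Longrightarrow> T (n + k - 1) = k"
    and "\<And>u. 1 \<le> u \<Longrightarrow> u < n \<Longrightarrow> node_ok key T u"
    and "1 \<le> u" "u < n" "\<not> above u (n + a - 1)"
  shows "node_ok (key(a := c)) T u"
proof -
  have "T w \<noteq> a" if "w = 2 * u \<or> w = 2 * u + 1" for w
  proof
    assume "T w = a"
    then have "w = n + a - 1 \<or> above w (n + a - 1)"
      using tree_path[OF assms(1,2), of w] that assms(3,4) by auto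
    then have "above (w div 2) (n + a - 1)"
      using above_half above.intros(1) by metis
    moreover have "w div 2 = u" using that by auto
    ultimately show False using assms(5) by simp
  qed
  then show ?thesis
    using assms(2)[OF assms(3,4)] by (simp add: node_ok_def better_def)
qed

text \<open>Repeating the match at the parent of v moves the zone of possibly wrong nodes one level
  up: a node that has this parent as a child lies above it, so all other nodes see no changed
  entry.\<close>

lemma tree_replay:
  assumes "\<And>u. 1 \<le> u \<Longrightarrow> u < n \<Longrightarrow> \<not> above u v \<Longrightarrow> node_ok key T u"
    and "1 \<le> u" "u < n" "\<not> above u (v div 2)"
  shows "node_ok key (T(v div 2 := better key (T (2 * (v div 2))) (T (2 * (v div 2) + 1)))) u"
proof (cases "u = v div 2")
  case True
  with assms(2) show ?thesis by (simp add: node_ok_def)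
next
  case False
  with assms above_cases[of u v] have "node_ok key T u" by blast
  moreover have "2 * u \<noteq> v div 2" "2 * u + 1 \<noteq> v div 2"
    using assms(4) above.intros(1)[of "v div 2"] by (metis nonzero_mult_div_cancel_left zero_neq_numeral,
      metis Suc_eq_plus1 even_Suc_div_two even_mult_iff even_numeral nonzero_mult_div_cancel_left zero_neq_numeral)
  ultimately show ?thesis using False by (simp add: node_ok_def)
qed

text \<open>Floor of the binary logarithm: the number of halvings from a node v to the root.\<close>

fun lg :: "nat \<Rightarrow> nat" where
  "lg v = (if v < 2 then 0 else Suc (lg (v div 2)))"

declare lg.simps [simp del]

lemma lg_mono: "u \<le> v \<Longrightarrow> lg u \<le> lg v"
proof (induction v arbitrary: u rule: lg.induct)
  case (1 v)
  show ?case
  proof (cases "u < 2")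
    case False
    with 1 have "lg (u div 2) \<le> lg (v div 2)" by (simp add: div_le_mono)
    with False 1(2) show ?thesis by (simp add: lg.simps[of u] lg.simps[of v])
  qed (simp add: lg.simps)
qed

lemma two_power_lg: "1 \<le> v \<Longrightarrow> 2 ^ lg v \<le> v"
proof (induction v rule: lg.induct)
  case (1 v)
  show ?case
  proof (cases "v < 2")
    case False
    with 1 have "2 ^ lg (v div 2) \<le> v div 2" by simp
    with False show ?thesis by (simp add: lg.simps[of v])
  qed (use 1 in \<open>simp add: lg.simps\<close>)
qed

section \<open>The program and its verification\<close>

definition scan_load :: com where
  "scan_load = Op (RAvg fX iI iC) ;; Op (ILd iD Bnd iC) ;; Op (RAvg fY iC iD)"

text \<open>There is no test for \<open>c = n + 1\<close>: there the oracle returns \<open>0\<close>, while all averages are positive.\<close>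

definition scan_loop :: com where
  "scan_loop = While (RLe fX fY) (Op (ISt Par iC iI) ;; Op (IPlus iC iD iZero) ;; scan_load)"

text \<open>The loop begins at i = n instead of n - 1: the scan there starts at n + 1 and stops at
  once, which gives \<open>b n = n + 1\<close>. On exit from a scan \<open>fX\<close> still holds
  the last average, which is \<open>y i\<close>.\<close>

definition block_loop :: com where
  "block_loop = While (ILe iOne iI)
     (Op (IPlus iC iI iOne) ;; scan_load ;; scan_loop ;; Op (ISt Bnd iI iC) ;; Op (RSt Key iI fX) ;;
      Op (IPlus iU iN iI) ;; Op (IMinus iU iU iOne) ;; Op (ISt Win iU iI) ;; Op (IMinus iI iI iOne))"

text \<open>The machine compares only by \<le>, so a tie is recognized by testing both directions
  and then goes to the smaller index. \<open>iU\<close> is left at the right child, where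
  \<open>build_loop\<close> continues.\<close>

definition play :: com where
  "play = Op (IPlus iU iV iV) ;; Op (ILd iA Win iU) ;; Op (IPlus iU iU iOne) ;; Op (ILd iD Win iU) ;;
     Op (RLd fX Key iA) ;; Op (RLd fY Key iD) ;;
     Cond (RLe fX fY)
       (Cond (RLe fY fX) (Cond (ILe iA iD) Skip (Op (IPlus iA iD iZero))) Skip)
       (Op (IPlus iA iD iZero)) ;;
     Op (ISt Win iV iA)"

text \<open>Leaf \<open>n + i - 1\<close> of the tree belongs to index \<open>i\<close>. The machine cannot halve node numbers, hence the
  table \<open>Half\<close>.\<close>

definition build_loop :: com where
  "build_loop = While (ILe iOne iV)
     (play ;; Op (ISt Half iU iV) ;; Op (IMinus iU iU iOne) ;; Op (ISt Half iU iV) ;;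
      Op (IMinus iV iV iOne))"

text \<open>\<open>fX\<close> is the value at the parent, which equals the current x of the picked
  index, so \<open>fY\<close> becomes the room left below \<open>q\<close>. For an outermost block
  the parent is 0, and \<open>Val\<close> at 0 is kept at 0.\<close>

definition settle :: com where
  "settle = Op (ILd iA Win iOne) ;; Op (ILd iD Bnd iA) ;; Op (ILd iC Par iA) ;;
     Op (RLd fX Val iC) ;; Op (RLd fY Val iA) ;; Op (RMinus fY fY fX) ;;
     Op (ROf fL iD) ;; Op (ROf fM iA) ;; Op (RMinus fL fL fM) ;;
     Op (RLd fM Key iA) ;; Op (RTimes fL fL fM) ;; Op (ROver fM fB fL) ;;
     Cond (RLe fM fY) (Op (RPlus fY fM fZero)) Skip ;;
     Op (RTimes fL fY fL) ;; Op (RMinus fB fB fL) ;; Op (RPlus fX fX fY) ;;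
     Op (RSt Val iA fX) ;; Op (RSt Key iA fBig) ;; Op (IPlus iV iN iA) ;; Op (IMinus iV iV iOne)"

definition replay_loop :: com where
  "replay_loop = While (ILe iTwo iV) (Op (ILd iV Half iV) ;; play)"

definition greedy_loop :: com where
  "greedy_loop = While (ILe iOne iJ) (settle ;; replay_loop ;; Op (IMinus iJ iJ iOne))"

definition algorithm :: com where
  "algorithm = Op (ISet iOne 1) ;; Op (ISet iZero 0) ;; Op (ISet iTwo 2) ;;
     Op (IPlus iI iN iZero) ;; block_loop ;;
     Op (IMinus iV iN iOne) ;; build_loop ;;
     Op (IPlus iU iN iOne) ;; Op (RAvg fX iOne iU) ;; Op (ROf fY iN) ;; Op (RTimes fX fX fY) ;;
     Op (RSet fY 1) ;; Op (RPlus fBig fX fY) ;; Op (RSet fZero 0) ;; Op (RSt Val iZero fZero) ;;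
     Op (IPlus iJ iN iZero) ;; greedy_loop"

lemma tick_sel [simp]: "ir (tick k s) = ir s" "ia (tick k s) = ia s" "rr (tick k s) = rr s" "ra (tick k s) = ra s"
  by (simp_all add: tick_def)

lemma wp_play:
  assumes "ir s iOne = 1" "ir s iZero = 0"
  defines "v \<equiv> ir s iV"
  shows "wp orc play (\<lambda>s'. clk s' \<le> clk s + 32 \<and> (\<forall>r. r \<notin> {iU, iA, iD} \<longrightarrow> ir s' r = ir s r)
    \<and> ir s' iU = 2 * v + 1
    \<and> ia s' = (ia s)(Win := (ia s Win)(v := better (ra s Key) (ia s Win (2 * v)) (ia s Win (2 * v + 1))))
    \<and> (\<forall>r. r \<notin> {fX, fY} \<longrightarrow> rr s' r = rr s r) \<and> ra s' = ra s) s"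
  unfolding play_def using assms
  by (auto simp: better_def tick_def mult_2)

text \<open>Potential for the amortized analysis, applied to the parent table: every jump of a scan
  raises it by 1.\<close>

definition count_pos :: "nat \<Rightarrow> (nat \<Rightarrow> nat) \<Rightarrow> nat" where
  "count_pos n f = card {k \<in> {1..n}. f k \<noteq> 0}"

lemma count_pos_le: "count_pos n f \<le> n"
proof -
  have "count_pos n f \<le> card {1..n}" unfolding count_pos_def by (rule card_mono) auto
  then show ?thesis by simp
qed

lemma count_pos_upd:
  assumes "1 \<le> c" "c \<le> n" "f c = 0" "1 \<le> i"
  shows "count_pos n (f(c := i)) = count_pos n f + 1"
proof -
  have "{k \<in> {1..n}. (f(c := i)) k \<noteq> 0} = insert c {k \<in> {1..n}. f k \<noteq> 0}"
    using assms by auto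
  then show ?thesis unfolding count_pos_def using assms(3) by simp
qed

section \<open>Amortized verification of the first phase\<close>

context problem
begin

abbreviation orc :: "nat \<Rightarrow> nat \<Rightarrow> real" where "orc \<equiv> avg_oracle z n"

definition base :: "(nat \<Rightarrow> real) \<Rightarrow> st \<Rightarrow> bool" where
  "base V s \<longleftrightarrow> ir s iN = n \<and> ir s iOne = 1 \<and> ir s iZero = 0 \<and> ir s iTwo = 2 \<and> ra s Val = V \<and> rr s fB = K"

definition blocks_from :: "nat \<Rightarrow> st \<Rightarrow> bool" where
  "blocks_from i s \<longleftrightarrow> (\<forall>k. i \<le> k \<and> k \<le> n \<longrightarrow>
     ia s Bnd k = b k \<and> ra s Key k = y k \<and> ia s Win (n + k - 1) = k)"

text \<open>\<open>e\<close> reserves steps for the rest of the pass. A jump costs 15: 2 for loop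
  control, 5 for the write to \<open>Par\<close>, 1 for moving c, 7 for \<open>scan_load\<close>. In
  the parent table i has been adopted only strictly between i and c.\<close>

definition scan_inv :: "(nat \<Rightarrow> real) \<Rightarrow> nat \<Rightarrow> nat \<Rightarrow> nat \<Rightarrow> st \<Rightarrow> bool" where
  "scan_inv V e T i s \<longleftrightarrow> base V s \<and> 1 \<le> i \<and> i \<le> n \<and> ir s iI = i \<and> scan i (ir s iC) \<and> blocks_from (i + 1) s
     \<and> (\<forall>k\<le>n. ia s Par k = (if i < k \<and> k < ir s iC then max (par (i + 1) k) i else par (i + 1) k))
     \<and> rr s fX = avg z i (ir s iC) \<and> (ir s iC \<le> n \<longrightarrow> ir s iD = b (ir s iC))
     \<and> rr s fY = (if ir s iC \<le> n then y (ir s iC) else 0)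
     \<and> clk s + e \<le> T + 15 * count_pos n (ia s Par)"

lemma scan_less: "scan i c \<Longrightarrow> i < c" "scan i c \<Longrightarrow> c \<le> n + 1"
  by (simp_all add: scan_def)

lemma orc_eqs:
  "scan i c \<Longrightarrow> 1 \<le> i \<Longrightarrow> orc i c = avg z i c"
  "1 \<le> c \<Longrightarrow> c \<le> n \<Longrightarrow> orc c (b c) = y c"
  "n < c \<Longrightarrow> orc c d = 0"
  using scan_less[of i c] b_bounds[of c] by (auto simp: avg_oracle_def yv_def)

lemma wp_scan_load:
  assumes "base V s" "1 \<le> i" "i \<le> n" "ir s iI = i" "scan i (ir s iC)" "blocks_from (i + 1) s"
    "\<forall>k\<le>n. ia s Par k = (if i < k \<and> k < ir s iC then max (par (i + 1) k) i else par (i + 1) k)"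
    "clk s + 7 + e \<le> T + 15 * count_pos n (ia s Par)"
  shows "wp orc scan_load (\<lambda>s'. scan_inv V e T i s' \<and> ir s' iC = ir s iC) s"
proof -
  have "i < ir s iC" "ir s iC \<le> n + 1" using scan_less assms(5) by auto
  moreover have "ir s iC \<le> n \<Longrightarrow> ia s Bnd (ir s iC) = b (ir s iC)"
    using assms(6) \<open>i < ir s iC\<close> by (simp add: blocks_from_def)
  ultimately show ?thesis
    using assms orc_eqs
    by (auto simp: scan_load_def scan_inv_def base_def blocks_from_def)
qed

lemma wp_scan_loop:
  assumes "scan_inv V e T i s"
  shows "wp orc scan_loop (\<lambda>s'. \<exists>s''. s' = tick 2 s'' \<and> scan_inv V e T i s'' \<and> b i = ir s'' iC) s"
  unfolding scan_loop_def
proof (rule wp_while[where I = "scan_inv V e T i" and \<mu> = "\<lambda>s. n + 1 - ir s iC"])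
  fix s assume inv: "scan_inv V e T i s" and "holds (RLe fX fY) s"
  then have le: "rr s fX \<le> rr s fY" by simp
  let ?c = "ir s iC"
  from inv have I: "base V s" "1 \<le> i" "i \<le> n" "ir s iI = i" "scan i ?c" "blocks_from (i + 1) s"
    "\<And>k. k \<le> n \<Longrightarrow> ia s Par k = (if i < k \<and> k < ?c then max (par (i + 1) k) i else par (i + 1) k)"
    "rr s fX = avg z i ?c" "?c \<le> n \<Longrightarrow> ir s iD = b ?c" "rr s fY = (if ?c \<le> n then y ?c else 0)"
    "clk s + e \<le> T + 15 * count_pos n (ia s Par)"
    unfolding scan_inv_def by blast+
  note c = scan_less[OF I(5)]
  have "0 < avg z i ?c" using avg_pos I(2) c by simp
  with le I(8,10) have cn: "?c \<le> n" and avg: "avg z i ?c \<le> y ?c" by (auto split: if_splits)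
  have nx: "scan i (b ?c)" using scan_jump[OF I(5) cn avg] nested cn c I(2) by simp
  have par0: "par (i + 1) ?c = 0" using par_scan_here[OF I(5)] .
  have cnt: "count_pos n ((ia s Par)(?c := i)) = count_pos n (ia s Par) + 1"
    using I(7)[OF cn] par0 cn c I(2) by (intro count_pos_upd) auto
  have bc: "?c < b ?c" "b ?c \<le> n + 1" using b_bounds cn by auto
  have par: "((ia s Par)(?c := i)) k = (if i < k \<and> k < b ?c then max (par (i + 1) k) i else par (i + 1) k)"
    if "k \<le> n" for k
  proof -
    consider "k < ?c" | "k = ?c" | "?c < k" "k < b ?c" | "b ?c \<le> k" by linarith
    then show ?thesis
    proof cases
      case 3
      then show ?thesis
        using par_scan_inside[of i ?c k] I(7)[OF that] I(2) c by auto
    qed (use I(7)[OF that] c bc par0 in auto)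
  qed
  define s1 where "s1 = s\<lparr>clk := clk s + 8, ia := (ia s)(Par := (ia s Par)(?c := i)), ir := (ir s)(iC := b ?c)\<rparr>"
  have "wp orc scan_load (\<lambda>s'. scan_inv V e T i s' \<and> ir s' iC = ir s1 iC) s1"
    by (rule wp_scan_load)
      (use I nx par cnt in \<open>simp_all add: s1_def base_def blocks_from_def\<close>)
  then have "wp orc scan_load (\<lambda>s'. scan_inv V e T i s' \<and> n + 1 - ir s' iC < n + 1 - ?c) s1"
    by (rule wp_mono) (use bc in \<open>auto simp: s1_def\<close>)
  moreover have "s1 = ex orc (IPlus iC iD iZero) (ex orc (ISt Par iC iI) (tick 2 s))"
    using I(1,4,9) cn by (simp add: s1_def base_def tick_def)
  ultimately show "wp orc (Op (ISt Par iC iI) ;; Op (IPlus iC iD iZero) ;; scan_load)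
     (\<lambda>s'. scan_inv V e T i s' \<and> n + 1 - ir s' iC < n + 1 - ir s iC) (tick 2 s)"
    by simp
next
  fix s assume inv: "scan_inv V e T i s" and "\<not> holds (RLe fX fY) s"
  then have "b i = ir s iC"
    by (intro scan_stop(1)) (auto simp: scan_inv_def)
  with inv show "\<exists>s''. tick 2 s = tick 2 s'' \<and> scan_inv V e T i s'' \<and> b i = ir s'' iC" by blast
qed (rule assms)

text \<open>Apart from jumps an index costs 30: 10 up to the end of the first
  \<open>scan_load\<close>, 2 for leaving the scan, 18 for the stores and the counter. During the
  scan of i, \<open>30 * i - 10\<close> is therefore reserved.\<close>

definition block_inv :: "(nat \<Rightarrow> real) \<Rightarrow> nat \<Rightarrow> st \<Rightarrow> bool" where
  "block_inv V T s \<longleftrightarrow> base V s \<and> ir s iI \<le> n \<and> blocks_from (ir s iI + 1) s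
     \<and> (\<forall>k\<le>n. ia s Par k = par (ir s iI + 1) k)
     \<and> clk s + 30 * ir s iI \<le> T + 15 * count_pos n (ia s Par)"

lemma wp_block_loop:
  assumes "block_inv V T s"
  shows "wp orc block_loop (\<lambda>s'. base V s' \<and> blocks_from 1 s' \<and> (\<forall>k\<le>n. ia s' Par k = par 1 k)
    \<and> clk s' \<le> T + 15 * n + 2) s"
  unfolding block_loop_def
proof (rule wp_while[where I = "block_inv V T" and \<mu> = "\<lambda>s. ir s iI"])
  fix s assume inv: "block_inv V T s" and h: "holds (ILe iOne iI) s"
  define i where "i = ir s iI"
  have I: "base V s" "1 \<le> i" "i \<le> n" "blocks_from (i + 1) s" "\<forall>k\<le>n. ia s Par k = par (i + 1) k"
    "clk s + 30 * i \<le> T + 15 * count_pos n (ia s Par)"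
    using inv h by (auto simp: block_inv_def i_def base_def)
  define s1 where "s1 = s\<lparr>clk := clk s + 3, ir := (ir s)(iC := i + 1)\<rparr>"
  have s1: "s1 = ex orc (IPlus iC iI iOne) (tick 2 s)"
    using I(1) by (simp add: s1_def base_def tick_def i_def)
  let ?tail = "Op (ISt Bnd iI iC) ;; Op (RSt Key iI fX) ;; Op (IPlus iU iN iI) ;;
    Op (IMinus iU iU iOne) ;; Op (ISt Win iU iI) ;; Op (IMinus iI iI iOne)"
  let ?Q = "\<lambda>s'. block_inv V T s' \<and> ir s' iI < ir s iI"
  have tail: "wp orc ?tail ?Q (tick 2 s')" if s': "scan_inv V (30 * i - 10) T i s'" "b i = ir s' iC" for s'
  proof -
    have J: "base V s'" "ir s' iI = i" "blocks_from (i + 1) s'" "rr s' fX = y i"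
      "\<forall>k\<le>n. ia s' Par k = par i k" "clk s' + (30 * i - 10) \<le> T + 15 * count_pos n (ia s' Par)"
      using s' par_step[OF I(2)] by (auto simp: scan_inv_def yv_def)
    have "30 * (i - 1) + 20 = 30 * i - 10" using I(2) by simp
    with J I(2,3) s'(2) show ?thesis
      by (auto simp: block_inv_def base_def blocks_from_def i_def[symmetric])
  qed
  have "wp orc scan_load (\<lambda>s'. scan_inv V (30 * i - 10) T i s' \<and> ir s' iC = ir s1 iC) s1"
    by (rule wp_scan_load)
      (use I scan_start[of i] in \<open>simp_all add: s1_def base_def blocks_from_def i_def[symmetric]\<close>)
  then have "wp orc scan_load (wp orc scan_loop (wp orc ?tail ?Q)) s1"
    by (rule wp_mono, elim conjE, intro wp_mono[OF wp_scan_loop]) (use tail in blast)+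
  then show "wp orc (Op (IPlus iC iI iOne) ;; scan_load ;; scan_loop ;; Op (ISt Bnd iI iC) ;; Op (RSt Key iI fX) ;;
      Op (IPlus iU iN iI) ;; Op (IMinus iU iU iOne) ;; Op (ISt Win iU iI) ;; Op (IMinus iI iI iOne))
    ?Q (tick 2 s)"
    using s1 by (simp only: wp_seq wp_op ok.simps simp_thms)
next
  fix s assume inv: "block_inv V T s" and h: "\<not> holds (ILe iOne iI) s"
  then have "ir s iI = 0" by (simp add: block_inv_def base_def)
  with inv count_pos_le[of n "ia s Par"]
  show "base V (tick 2 s) \<and> blocks_from 1 (tick 2 s) \<and> (\<forall>k\<le>n. ia (tick 2 s) Par k = par 1 k)
    \<and> clk (tick 2 s) \<le> T + 15 * n + 2"
    by (auto simp: block_inv_def base_def blocks_from_def)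
qed (rule assms)

section \<open>Building the tournament tree\<close>

definition leaves :: "st \<Rightarrow> bool" where
  "leaves s \<longleftrightarrow> (\<forall>k. 1 \<le> k \<and> k \<le> n \<longrightarrow> ia s Win (n + k - 1) = k)"

lemma leaves_inner_upd:
  assumes "leaves s" "ia s' Win = (ia s Win)(v := w)" "v < n"
  shows "leaves s'"
  using assms by (auto simp: leaves_def)

definition tables :: "st \<Rightarrow> bool" where
  "tables s \<longleftrightarrow> ir s iN = n \<and> ir s iOne = 1 \<and> ir s iZero = 0 \<and> ir s iTwo = 2 \<and> leaves s
     \<and> (\<forall>k. 1 \<le> k \<and> k \<le> n \<longrightarrow> ia s Bnd k = b k \<and> ia s Par k = par 1 k)"

text \<open>The round of node v also writes the \<open>Half\<close> entries of its children 2 v and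
  2 v + 1, hence the threshold 2 v + 2. It costs 46: 2 for the loop, 32 for \<open>play\<close>, 12
  for the rest.\<close>

definition build_inv :: "st \<Rightarrow> nat \<Rightarrow> st \<Rightarrow> bool" where
  "build_inv s0 T s \<longleftrightarrow> tables s \<and> ra s = ra s0 \<and> rr s fB = rr s0 fB \<and> ir s iV < n
     \<and> (\<forall>u. ir s iV < u \<and> u < n \<longrightarrow> node_ok (ra s Key) (ia s Win) u)
     \<and> (\<forall>u. 2 * ir s iV + 2 \<le> u \<and> u < 2 * n \<longrightarrow> ia s Half u = u div 2)
     \<and> clk s + 46 * ir s iV \<le> T"

lemma wp_build_loop:
  assumes "build_inv s0 T s"
  shows "wp orc build_loop (\<lambda>s'. tables s' \<and> ra s' = ra s0 \<and> rr s' fB = rr s0 fB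
    \<and> (\<forall>u. 1 \<le> u \<and> u < n \<longrightarrow> node_ok (ra s' Key) (ia s' Win) u)
    \<and> (\<forall>u. 2 \<le> u \<and> u < 2 * n \<longrightarrow> ia s' Half u = u div 2) \<and> clk s' \<le> T + 2) s"
  unfolding build_loop_def
proof (rule wp_while[where I = "build_inv s0 T" and \<mu> = "\<lambda>s. ir s iV"])
  fix s assume inv: "build_inv s0 T s" and h: "holds (ILe iOne iV) s"
  define v where "v = ir s iV"
  have I: "tables s" "ra s = ra s0" "rr s fB = rr s0 fB" "v < n"
    "\<And>u. v < u \<Longrightarrow> u < n \<Longrightarrow> node_ok (ra s Key) (ia s Win) u"
    "\<And>u. 2 * v + 2 \<le> u \<Longrightarrow> u < 2 * n \<Longrightarrow> ia s Half u = u div 2" "clk s + 46 * v \<le> T"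
    using inv unfolding build_inv_def v_def by blast+
  have v: "1 \<le> v" "v < n" using I(1,4) h by (auto simp: tables_def v_def)
  let ?tail = "Op (ISt Half iU iV) ;; Op (IMinus iU iU iOne) ;; Op (ISt Half iU iV) ;;
    Op (IMinus iV iV iOne)"
  let ?Q = "\<lambda>s'. build_inv s0 T s' \<and> ir s' iV < ir s iV"
  have "wp orc play (wp orc ?tail ?Q) (tick 2 s)"
  proof (rule wp_mono[OF wp_play])
    show "ir (tick 2 s) iOne = 1" "ir (tick 2 s) iZero = 0"
      using I(1) by (simp_all add: tables_def)
  next
    fix s' :: st
    let ?w = "better (ra s Key) (ia s Win (2 * v)) (ia s Win (2 * v + 1))"
    assume "clk s' \<le> clk (tick 2 s) + 32 \<and> (\<forall>r. r \<notin> {iU, iA, iD} \<longrightarrow> ir s' r = ir (tick 2 s) r)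
      \<and> ir s' iU = 2 * ir (tick 2 s) iV + 1
      \<and> ia s' = (ia (tick 2 s))(Win := (ia (tick 2 s) Win)(ir (tick 2 s) iV :=
          better (ra (tick 2 s) Key) (ia (tick 2 s) Win (2 * ir (tick 2 s) iV)) (ia (tick 2 s) Win (2 * ir (tick 2 s) iV + 1))))
      \<and> (\<forall>r. r \<notin> {fX, fY} \<longrightarrow> rr s' r = rr (tick 2 s) r) \<and> ra s' = ra (tick 2 s)"
    then have s': "clk s' \<le> clk s + 34" "\<And>r. r \<notin> {iU, iA, iD} \<Longrightarrow> ir s' r = ir s r" "ir s' iU = 2 * v + 1"
      "ia s' = (ia s)(Win := (ia s Win)(v := ?w))" "rr s' fB = rr s fB" "ra s' = ra s"
      by (auto simp: v_def)
    have regs: "ir s' iN = n" "ir s' iOne = 1" "ir s' iZero = 0" "ir s' iTwo = 2" "ir s' iV = v"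
      using s'(2) I(1) by (simp_all add: tables_def v_def)
    have lv: "leaves s'"
      using leaves_inner_upd[of s s' v ?w] I(1) s'(4) v(2) by (simp add: tables_def)
    have node: "node_ok (ra s Key) ((ia s Win)(v := ?w)) u" if "v - 1 < u" "u < n" for u
    proof (cases "u = v")
      case False
      with that v(1) have "v < u" by simp
      with I(5)[of u] that(2) show ?thesis by (simp add: node_ok_def)
    qed (use v(1) in \<open>simp add: node_ok_def\<close>)
    have half: "((ia s Half)(2 * v + 1 := v, 2 * v := v)) u = u div 2" if "2 * (v - 1) + 2 \<le> u" "u < 2 * n" for u
    proof -
      consider "u = 2 * v" | "u = 2 * v + 1" | "2 * v + 2 \<le> u" using \<open>2 * (v - 1) + 2 \<le> u\<close> v(1) by linarith
      then show ?thesis using that I(6)[of u] by cases simp_all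
    qed
    have "46 * (v - 1) + 46 = 46 * v" using v(1) by simp
    with I(7) s'(1) have clk': "clk s' + 12 + 46 * (v - 1) \<le> T" by linarith
    define s4 where "s4 = s'\<lparr>ia := (ia s')(Half := (ia s Half)(2 * v + 1 := v, 2 * v := v)),
      clk := 12 + clk s', ir := (ir s')(iU := 2 * v, iV := v - 1)\<rparr>"
    have "tables s4"
      using regs lv s'(4) I(1) by (simp add: s4_def tables_def leaves_def)
    moreover have "ra s4 = ra s0" "rr s4 fB = rr s0 fB" "ir s4 iV = v - 1" "ia s4 Half = (ia s Half)(2 * v + 1 := v, 2 * v := v)"
      "ra s4 Key = ra s Key" "ia s4 Win = (ia s Win)(v := ?w)" "clk s4 = clk s' + 12"
      using s'(4-6) I(2,3) by (simp_all add: s4_def)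
    ultimately have "build_inv s0 T s4"
      using node half clk' v unfolding build_inv_def by (simp del: fun_upd_apply)
    then have "?Q s4" using v by (simp add: s4_def v_def)
    moreover have "wp orc ?tail ?Q s' \<longleftrightarrow> ?Q s4"
      using regs s'(3,4) v(1) by (simp add: s4_def)
    ultimately show "wp orc ?tail ?Q s'" by blast
  qed
  then show "wp orc (play ;; Op (ISt Half iU iV) ;; Op (IMinus iU iU iOne) ;; Op (ISt Half iU iV) ;;
      Op (IMinus iV iV iOne)) ?Q (tick 2 s)"
    by (simp only: wp_seq)
next
  fix s assume inv: "build_inv s0 T s" and h: "\<not> holds (ILe iOne iV) s"
  then have "ir s iV = 0" by (simp add: build_inv_def tables_def)
  with inv show "tables (tick 2 s) \<and> ra (tick 2 s) = ra s0 \<and> rr (tick 2 s) fB = rr s0 fB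
    \<and> (\<forall>u. 1 \<le> u \<and> u < n \<longrightarrow> node_ok (ra (tick 2 s) Key) (ia (tick 2 s) Win) u)
    \<and> (\<forall>u. 2 \<le> u \<and> u < 2 * n \<longrightarrow> ia (tick 2 s) Half u = u div 2) \<and> clk (tick 2 s) \<le> T + 2"
    by (auto simp: build_inv_def tables_def leaves_def)
qed (rule assms)

section \<open>The greedy phase on the machine\<close>

text \<open>Settled indices stay in the tree with this key, which exceeds every \<open>y\<close>.\<close>

definition big_key :: real where "big_key = avg z 1 (n + 1) * real n + 1"

text \<open>\<open>Val\<close> holds the input \<open>q k\<close> until k is settled and the output
  afterwards. The current x of an unsettled index is not stored, being the value at its
  parent.\<close>

definition vals :: "nat \<Rightarrow> st \<Rightarrow> bool" where
  "vals m s \<longleftrightarrow> (case run m of (S, x, B) \<Rightarrow> rr s fB = B \<and> rr s fBig = big_key \<and> rr s fZero = 0 \<and> ra s Val 0 = 0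
     \<and> (\<forall>k. 1 \<le> k \<and> k \<le> n \<longrightarrow> ra s Key k = (if k \<in> S then big_key else y k)
         \<and> ra s Val k = (if k \<in> S then x k else q k)))"

text \<open>Only ancestors of the current node may be wrong. \<open>lg\<close> counts the levels
  left to climb, each for 39 steps: 2 for the loop, 5 for the halving, 32 for
  \<open>play\<close>.\<close>

definition replay_inv :: "nat \<Rightarrow> nat \<Rightarrow> nat \<Rightarrow> st \<Rightarrow> bool" where
  "replay_inv m j T s \<longleftrightarrow> tables s \<and> (\<forall>u. 2 \<le> u \<and> u < 2 * n \<longrightarrow> ia s Half u = u div 2) \<and> vals m s
     \<and> 1 \<le> ir s iV \<and> ir s iV < 2 * n \<and> ir s iJ = j
     \<and> (\<forall>u. 1 \<le> u \<and> u < n \<and> \<not> above u (ir s iV) \<longrightarrow> node_ok (ra s Key) (ia s Win) u)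
     \<and> clk s + 39 * lg (ir s iV) \<le> T"

lemma wp_replay_loop:
  assumes "replay_inv m j T s"
  shows "wp orc replay_loop (\<lambda>s'. replay_inv m j (T + 2) s' \<and> ir s' iV = 1) s"
  unfolding replay_loop_def
proof (rule wp_while[where I = "replay_inv m j T" and \<mu> = "\<lambda>s. ir s iV"])
  fix s assume inv: "replay_inv m j T s" and h: "holds (ILe iTwo iV) s"
  define v where "v = ir s iV div 2"
  have I: "tables s" "\<And>u. 2 \<le> u \<Longrightarrow> u < 2 * n \<Longrightarrow> ia s Half u = u div 2" "vals m s"
    "ir s iV < 2 * n" "ir s iJ = j" "clk s + 39 * lg (ir s iV) \<le> T"
    "\<And>u. 1 \<le> u \<Longrightarrow> u < n \<Longrightarrow> \<not> above u (ir s iV) \<Longrightarrow> node_ok (ra s Key) (ia s Win) u"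
    using inv unfolding replay_inv_def by blast+
  have V: "2 \<le> ir s iV" "ir s iV < 2 * n" using I(1,4) h by (auto simp: tables_def)
  then have v: "1 \<le> v" "v < n" "v < ir s iV" by (auto simp: v_def)
  let ?Q = "\<lambda>s'. replay_inv m j T s' \<and> ir s' iV < ir s iV"
  define s1 where "s1 = s\<lparr>clk := clk s + 7, ir := (ir s)(iV := v)\<rparr>"
  have s1: "s1 = ex orc (ILd iV Half iV) (tick 2 s)"
    using I(2) V by (simp add: s1_def tick_def v_def)
  have "wp orc play ?Q s1"
  proof (rule wp_mono[OF wp_play])
    show "ir s1 iOne = 1" "ir s1 iZero = 0"
      using I(1) by (simp_all add: tables_def s1_def)
  next
    fix s' :: st
    let ?w = "better (ra s Key) (ia s Win (2 * v)) (ia s Win (2 * v + 1))"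
    assume "clk s' \<le> clk s1 + 32 \<and> (\<forall>r. r \<notin> {iU, iA, iD} \<longrightarrow> ir s' r = ir s1 r)
      \<and> ir s' iU = 2 * ir s1 iV + 1
      \<and> ia s' = (ia s1)(Win := (ia s1 Win)(ir s1 iV :=
          better (ra s1 Key) (ia s1 Win (2 * ir s1 iV)) (ia s1 Win (2 * ir s1 iV + 1))))
      \<and> (\<forall>r. r \<notin> {fX, fY} \<longrightarrow> rr s' r = rr s1 r) \<and> ra s' = ra s1"
    then have s': "clk s' \<le> clk s + 39" "\<And>r. r \<notin> {iU, iA, iD} \<Longrightarrow> ir s' r = ir s1 r"
      "ia s' = (ia s)(Win := (ia s Win)(v := ?w))" "\<And>r. r \<notin> {fX, fY} \<Longrightarrow> rr s' r = rr s r" "ra s' = ra s"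
      by (auto simp: s1_def)
    have regs: "ir s' iN = n" "ir s' iOne = 1" "ir s' iZero = 0" "ir s' iTwo = 2" "ir s' iV = v" "ir s' iJ = j"
      using s'(2) I(1,5) by (simp_all add: tables_def s1_def)
    have lv: "leaves s'"
      using leaves_inner_upd[of s s' v ?w] I(1) s'(3) v(2) by (simp add: tables_def)
    have node: "node_ok (ra s Key) ((ia s Win)(v := ?w)) u" if "1 \<le> u" "u < n" "\<not> above u v" for u
      using tree_replay[of n "ir s iV" "ra s Key" "ia s Win" u] I(7) that by (simp add: v_def del: fun_upd_apply)
    have "lg (ir s iV) = Suc (lg v)" using V(1) by (simp add: lg.simps[of "ir s iV"] v_def)
    then have clk': "clk s' + 39 * lg v \<le> T" using s'(1) I(6) by simp
    have vl: "vals m s'" using I(3) s'(4,5) by (simp add: vals_def)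
    have tb: "tables s'" using regs lv I(1) s'(3) by (simp add: tables_def)
    have hf: "ia s' Half = ia s Half" and wn: "ia s' Win = (ia s Win)(v := ?w)" using s'(3) by simp_all
    show "?Q s'"
      unfolding replay_inv_def hf wn s'(5) regs using vl tb I(2) node clk' v by simp
  qed
  then show "wp orc (Op (ILd iV Half iV) ;; play) ?Q (tick 2 s)"
    by (simp only: wp_seq wp_op ok.simps s1 simp_thms)
next
  fix s assume inv: "replay_inv m j T s" and "\<not> holds (ILe iTwo iV) s"
  then have "ir s iV = 1" by (auto simp: replay_inv_def tables_def)
  with inv show "replay_inv m j (T + 2) (tick 2 s) \<and> ir (tick 2 s) iV = 1"
    by (auto simp: replay_inv_def tables_def leaves_def vals_def)
qed (rule assms)

lemma wp_settle:
  assumes "ir s iOne = 1" "rr s fZero = 0" "1 \<le> ir s iN"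
  defines "a \<equiv> ia s Win 1"
  defines "w \<equiv> (real (ia s Bnd a) - real a) * ra s Key a"
  defines "p \<equiv> ra s Val (ia s Par a)"
  defines "d \<equiv> min (rr s fB / w) (ra s Val a - p)"
  shows "wp oc settle (\<lambda>s'. clk s' \<le> clk s + 53 \<and> (\<forall>r. r \<notin> {iA, iD, iC, iV} \<longrightarrow> ir s' r = ir s r)
    \<and> ir s' iV = ir s iN + a - 1 \<and> ia s' = ia s \<and> rr s' fB = rr s fB - d * w \<and> rr s' fBig = rr s fBig
    \<and> rr s' fZero = 0
    \<and> ra s' = (ra s)(Val := (ra s Val)(a := p + d), Key := (ra s Key)(a := rr s fBig))) s"
  unfolding settle_def using assms(1-3)
  by (auto simp: a_def w_def p_def d_def min_def tick_def)

text \<open>A round costs 53 for \<open>settle\<close>, at most 39 per level of the tree, and 5 for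
  control: 2 for this loop, 2 for leaving the replay, 1 for the counter.\<close>

definition greedy_inv :: "nat \<Rightarrow> st \<Rightarrow> bool" where
  "greedy_inv T s \<longleftrightarrow> ir s iJ \<le> n \<and> tables s \<and> (\<forall>u. 2 \<le> u \<and> u < 2 * n \<longrightarrow> ia s Half u = u div 2)
     \<and> vals (n - ir s iJ) s \<and> (\<forall>u. 1 \<le> u \<and> u < n \<longrightarrow> node_ok (ra s Key) (ia s Win) u)
     \<and> clk s + (58 + 39 * lg (2 * n)) * ir s iJ \<le> T"

lemma wp_settle_round:
  assumes inv: "greedy_inv T s" and j: "1 \<le> ir s iJ"
  shows "wp orc settle
    (replay_inv (Suc (n - ir s iJ)) (ir s iJ) (clk s + 55 + 39 * lg (2 * n))) (tick 2 s)"
proof -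
  define m where "m = n - ir s iJ"
  define a where "a = ia s Win 1"
  obtain S x B where r: "run m = (S, x, B)" by (cases "run m") auto
  have m: "m < n" using inv j by (auto simp: m_def greedy_inv_def)
  have rinv: "run_inv m (S, x, B)" using run_inv[of m] m r by simp
  have ne: "{1..n} - S \<noteq> {}" using run_inv_nonempty[OF rinv m] .
  have tab: "tables s" and half: "\<forall>u. 2 \<le> u \<and> u < 2 * n \<longrightarrow> ia s Half u = u div 2" and "vals m s"
    and node: "\<And>u. 1 \<le> u \<Longrightarrow> u < n \<Longrightarrow> node_ok (ra s Key) (ia s Win) u"
    using inv unfolding greedy_inv_def m_def by blast+
  then have v: "rr s fB = B" "rr s fBig = big_key" "rr s fZero = 0" "ra s Val 0 = 0"
    and key: "\<And>k. 1 \<le> k \<Longrightarrow> k \<le> n \<Longrightarrow> ra s Key k = (if k \<in> S then big_key else y k)"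
    and val: "\<And>k. 1 \<le> k \<Longrightarrow> k \<le> n \<Longrightarrow> ra s Val k = (if k \<in> S then x k else q k)"
    unfolding vals_def r prod.case by blast+
  have rpar: "\<And>k. k \<in> {1..n} - S \<Longrightarrow> x k = x (par 1 k)" and x0: "x 0 = 0"
    using rinv unfolding run_inv_def prod.case by blast+
  have lv: "\<And>k. 1 \<le> k \<Longrightarrow> k \<le> n \<Longrightarrow> ia s Win (n + k - 1) = k"
    using tab by (simp add: tables_def leaves_def)
  have a: "1 \<le> a" "a \<le> n"
    using tree_range[OF lv node, of 1] n_pos by (auto simp: a_def)
  have root: "ra s Key a < ra s Key k \<or> ra s Key a = ra s Key k \<and> a \<le> k" if "1 \<le> k" "k \<le> n" for k
    using tree_root[OF lv node that] by (simp add: a_def)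
  \<comment> \<open>A settled winner would carry \<open>big_key\<close> and lose to any unsettled
    index, of which there is at least one.\<close>
  have aS: "a \<notin> S"
  proof
    assume "a \<in> S"
    obtain k where k: "k \<in> {1..n} - S" using ne by blast
    then have "ra s Key k < ra s Key a"
      using \<open>a \<in> S\<close> key[of k] key[of a] a y_less_big[of k] by (auto simp: big_key_def)
    then show False using root[of k] k by auto
  qed
  have pick: "pick S = a"
  proof (rule pick_eq)
    show "before a k" if "k \<in> {1..n} - S" "k \<noteq> a" for k
      using root[of k] key[of k] key[of a] a aS that by (auto simp: before_def)
  qed (use a aS in simp)
  have par: "ra s Val (par 1 a) = x a"
  proof -
    have "x a = x (par 1 a)" using a aS by (intro rpar) simp
    moreover have "ra s Val (par 1 a) = x (par 1 a)"
    proof (rule par_cases[of 1 a])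
      assume "par 1 a = 0"
      then show ?thesis using v(4) x0 by simp
    next
      assume p: "1 \<le> par 1 a" "par 1 a < a" "a < b (par 1 a)"
      \<comment> \<open>The parent has no larger \<open>y\<close> and a smaller index, so it
        precedes a and must have been settled before a is picked.\<close>
      have "y (par 1 a) \<le> y a" using y_le_inner p a by simp
      then have "\<not> before a (par 1 a)" using p by (auto simp: before_def)
      then have "par 1 a \<in> S" using pick_props(2)[OF ne, of "par 1 a"] pick p a by auto
      then show ?thesis using val p a by simp
    qed
    ultimately show ?thesis by simp
  qed
  define w where "w = real (b a - a) * y a"
  define d where "d = min (B / w) (q a - x a)"
  have d: "incr (S, x, B) = d" by (simp add: incr_def pick d_def w_def)
  have w: "(real (ia s Bnd a) - real a) * ra s Key a = w"
    using tab a aS key[of a] b_bounds(1)[of a] by (simp add: tables_def w_def of_nat_diff less_imp_le)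
  have d': "min (rr s fB / w) (ra s Val a - ra s Val (ia s Par a)) = d"
    using tab a aS val[of a] par v(1) by (simp add: tables_def d_def)
  have pv: "ra s Val (ia s Par a) = x a" using tab a par by (simp add: tables_def)
  have "ir (tick 2 s) iOne = 1" "rr (tick 2 s) fZero = 0" "1 \<le> ir (tick 2 s) iN" and N: "ir s iN = n"
    using tab v(3) n_pos by (simp_all add: tables_def)
  note exec = wp_settle[OF this(1-3), of orc, unfolded tick_sel clk_tick, folded a_def,
    unfolded w, unfolded d', unfolded pv v(1,2) N]
  show ?thesis
  proof (rule wp_mono[OF exec])
    fix s' :: st
    assume s': "clk s' \<le> clk s + 2 + 53 \<and> (\<forall>r. r \<notin> {iA, iD, iC, iV} \<longrightarrow> ir s' r = ir s r)
    \<and> ir s' iV = n + a - 1 \<and> ia s' = ia s \<and> rr s' fB = B - d * w \<and> rr s' fBig = big_key \<and> rr s' fZero = 0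
    \<and> ra s' = (ra s)(Val := (ra s Val)(a := x a + d), Key := (ra s Key)(a := big_key))"
    show "replay_inv (Suc (n - ir s iJ)) (ir s iJ) (clk s + 55 + 39 * lg (2 * n)) s'"
      unfolding replay_inv_def
    proof (intro conjI)
      have e: "clk s' \<le> clk s + 55" "ir s' iN = ir s iN" "ir s' iOne = ir s iOne" "ir s' iZero = ir s iZero"
        "ir s' iTwo = ir s iTwo" "ir s' iJ = ir s iJ" "ir s' iV = n + a - 1" "ia s' = ia s"
        "ra s' Key = (ra s Key)(a := big_key)" "ra s' Val = (ra s Val)(a := x a + d)"
        using s' by simp_all
      show "tables s'" using e tab by (simp add: tables_def leaves_def)
      show "\<forall>u. 2 \<le> u \<and> u < 2 * n \<longrightarrow> ia s' Half u = u div 2" using e(8) half by simp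
      show "1 \<le> ir s' iV" "ir s' iV < 2 * n" "ir s' iJ = ir s iJ" using e(6,7) a by simp_all
      have "lg (ir s' iV) \<le> lg (2 * n)" using e(7) a by (intro lg_mono) simp
      then show "clk s' + 39 * lg (ir s' iV) \<le> clk s + 55 + 39 * lg (2 * n)" using e(1) by linarith
      show "\<forall>u. 1 \<le> u \<and> u < n \<and> \<not> above u (ir s' iV) \<longrightarrow> node_ok (ra s' Key) (ia s' Win) u"
        using tree_key_update[OF lv node, of _ a big_key] unfolding e by blast
      define x' where "x' = (\<lambda>k. if a \<le> k \<and> k < b a then x k + d else x k)"
      have run': "run (Suc m) = (insert a S, x', B - d * w)"
        by (simp add: r fstep_def pick d x'_def w_def mult.assoc cong: if_cong)
      have xa: "x' a = x a + d" using b_bounds(1)[of a] a by (simp add: x'_def)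
      have xS: "x' k = x k" if "k \<in> S" "1 \<le> k" "k \<le> n" for k
        using pick_block_done[OF rinv ne, of k] that unfolding pick x'_def by auto
      have "ra s' Key k = (if k \<in> insert a S then big_key else y k)
          \<and> ra s' Val k = (if k \<in> insert a S then x' k else q k)" if "1 \<le> k" "k \<le> n" for k
        unfolding e using key[OF that] val[OF that] xa xS[OF _ that] aS by (cases "k = a") simp_all
      moreover have "ra s' Val 0 = 0" unfolding e using v(4) a by simp
      ultimately show "vals (Suc (n - ir s iJ)) s'"
        unfolding m_def[symmetric] vals_def run' prod.case using s' by blast
    qed
  qed
qed

lemma wp_greedy_loop:
  assumes "greedy_inv T s"
  shows "wp orc greedy_loop (\<lambda>s'. ir s' iN = n \<and> (\<forall>k. 1 \<le> k \<and> k \<le> n \<longrightarrow> ra s' Val k = alg2 q z n K k)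
    \<and> clk s' \<le> T + 2) s"
  unfolding greedy_loop_def
proof (rule wp_while[where I = "greedy_inv T" and \<mu> = "\<lambda>s. ir s iJ"])
  fix s assume inv: "greedy_inv T s" and h: "holds (ILe iOne iJ) s"
  define j c where "j = ir s iJ" and "c = 58 + 39 * lg (2 * n)"
  have I: "j \<le> n" "tables s" "clk s + c * j \<le> T"
    using inv unfolding greedy_inv_def j_def c_def by blast+
  have j: "1 \<le> j" using h I(2) by (simp add: tables_def j_def)
  let ?T = "clk s + 55 + 39 * lg (2 * n)"
  let ?Q = "\<lambda>s'. greedy_inv T s' \<and> ir s' iJ < ir s iJ"
  have "wp orc settle (replay_inv (Suc (n - j)) j ?T) (tick 2 s)"
    using wp_settle_round[OF inv] j by (simp add: j_def)
  then have "wp orc settle (wp orc replay_loop (wp orc (Op (IMinus iJ iJ iOne)) ?Q)) (tick 2 s)"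
  proof (rule wp_mono)
    fix s1 assume "replay_inv (Suc (n - j)) j ?T s1"
    then show "wp orc replay_loop (wp orc (Op (IMinus iJ iJ iOne)) ?Q) s1"
    proof (rule wp_mono[OF wp_replay_loop])
      fix s2 assume a: "replay_inv (Suc (n - j)) j (?T + 2) s2 \<and> ir s2 iV = 1"
      then have R: "tables s2" "\<forall>u. 2 \<le> u \<and> u < 2 * n \<longrightarrow> ia s2 Half u = u div 2" "vals (Suc (n - j)) s2"
        "ir s2 iJ = j" "\<And>u. 1 \<le> u \<Longrightarrow> u < n \<Longrightarrow> \<not> above u 1 \<Longrightarrow> node_ok (ra s2 Key) (ia s2 Win) u"
        "clk s2 \<le> ?T + 2"
        unfolding replay_inv_def by (blast, blast, blast, blast, metis, linarith)
      \<comment> \<open>\<open>above u 1\<close> forces \<open>u = 0\<close>, so at the root no node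
        is exempt any more.\<close>
      have node: "\<forall>u. 1 \<le> u \<and> u < n \<longrightarrow> node_ok (ra s2 Key) (ia s2 Win) u"
        using R(5) above_one by fastforce
      define s3 where "s3 = ex orc (IMinus iJ iJ iOne) s2"
      have one: "ir s2 iOne = 1" using R(1) by (simp add: tables_def)
      have e: "ir s3 iJ = j - 1" "ir s3 iN = ir s2 iN" "ir s3 iOne = ir s2 iOne" "ir s3 iZero = ir s2 iZero"
        "ir s3 iTwo = ir s2 iTwo" "ia s3 = ia s2" "rr s3 = rr s2" "ra s3 = ra s2" "clk s3 = clk s2 + 1"
        using one R(4) by (simp_all add: s3_def)
      have "tables s3" using R(1) by (simp add: tables_def leaves_def e)
      moreover have "vals (n - (j - 1)) s3"
      proof -
        have "n - (j - 1) = Suc (n - j)" using j I(1) by simp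
        then show ?thesis using R(3) by (simp only: vals_def e)
      qed
      moreover have "clk s3 + c * (j - 1) \<le> T"
      proof -
        have "c * (j - 1) + c = c * j" using j by (cases j) simp_all
        then show ?thesis using I(3) R(6) e(9) unfolding c_def by linarith
      qed
      ultimately have "greedy_inv T s3"
        unfolding greedy_inv_def e c_def[symmetric] using R(2) node I(1) by auto
      then show "wp orc (Op (IMinus iJ iJ iOne)) ?Q s2"
        using e(1) j one R(4) by (simp add: s3_def j_def)
    qed
  qed
  then show "wp orc (settle ;; replay_loop ;; Op (IMinus iJ iJ iOne)) ?Q (tick 2 s)"
    by (simp only: wp_seq)
next
  fix s assume inv: "greedy_inv T s" and h: "\<not> holds (ILe iOne iJ) s"
  have I: "tables s" "vals (n - ir s iJ) s" "clk s \<le> T"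
    using inv unfolding greedy_inv_def by auto
  have j: "ir s iJ = 0" using h I(1) by (simp add: tables_def)
  obtain S x B where r: "run n = (S, x, B)" by (cases "run n") auto
  have "card ({1..n} - S) = 0" using run_inv[of n] r by (simp add: run_inv_def)
  then have "{1..n} \<subseteq> S" by simp
  moreover have "\<And>k. 1 \<le> k \<Longrightarrow> k \<le> n \<Longrightarrow> ra s Val k = (if k \<in> S then x k else q k)"
    using I(2) unfolding vals_def j minus_nat.diff_0 r prod.case by blast
  ultimately have "ra s Val k = alg2 q z n K k" if "1 \<le> k" "k \<le> n" for k
    using that by (simp add: alg2_eq_run r subset_iff)
  then show "ir (tick 2 s) iN = n \<and> (\<forall>k. 1 \<le> k \<and> k \<le> n \<longrightarrow> ra (tick 2 s) Val k = alg2 q z n K k)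
    \<and> clk (tick 2 s) \<le> T + 2"
    using I by (simp add: tables_def)
qed (rule assms)

lemma wp_algorithm:
  assumes "ir s iN = n" "\<And>k. k \<le> n \<Longrightarrow> ia s Par k = 0" "\<And>k. 1 \<le> k \<Longrightarrow> k \<le> n \<Longrightarrow> ra s Val k = q k"
    "rr s fB = K" "clk s = 0"
  shows "wp orc algorithm (\<lambda>s'. ir s' iN = n \<and> (\<forall>k. 1 \<le> k \<and> k \<le> n \<longrightarrow> ra s' Val k = alg2 q z n K k)
    \<and> clk s' \<le> (149 + 39 * lg (2 * n)) * n + 24) s"
proof -
  let ?Q = "\<lambda>s'. ir s' iN = n \<and> (\<forall>k. 1 \<le> k \<and> k \<le> n \<longrightarrow> ra s' Val k = alg2 q z n K k)
    \<and> clk s' \<le> (149 + 39 * lg (2 * n)) * n + 24"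
  let ?A = "Op (ISet iOne 1) ;; Op (ISet iZero 0) ;; Op (ISet iTwo 2) ;; Op (IPlus iI iN iZero)"
  let ?B = "Op (IMinus iV iN iOne)"
  let ?C = "Op (IPlus iU iN iOne) ;; Op (RAvg fX iOne iU) ;; Op (ROf fY iN) ;; Op (RTimes fX fX fY) ;;
     Op (RSet fY 1) ;; Op (RPlus fBig fX fY) ;; Op (RSet fZero 0) ;; Op (RSt Val iZero fZero) ;;
     Op (IPlus iJ iN iZero)"
  let ?V = "ra s Val"
  have "wp orc ?A (block_inv ?V (30 * n + 4)) s"
    using assms(1,2,4,5) by (simp add: block_inv_def base_def blocks_from_def par_beyond)
  then have "wp orc ?A (wp orc block_loop (wp orc ?B (wp orc build_loop (wp orc ?C (wp orc greedy_loop ?Q))))) s"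
  proof (rule wp_mono, elim wp_mono[OF wp_block_loop])
    fix s1
    assume s1: "base ?V s1 \<and> blocks_from 1 s1 \<and> (\<forall>k\<le>n. ia s1 Par k = par 1 k) \<and> clk s1 \<le> 30 * n + 4 + 15 * n + 2"
    then have "wp orc ?B (build_inv s1 (91 * n + 7)) s1"
      using n_pos by (auto simp: build_inv_def tables_def leaves_def base_def blocks_from_def)
    then show "wp orc ?B (wp orc build_loop (wp orc ?C (wp orc greedy_loop ?Q))) s1"
    proof (rule wp_mono, elim wp_mono[OF wp_build_loop])
      fix s2
      assume s2: "tables s2 \<and> ra s2 = ra s1 \<and> rr s2 fB = rr s1 fB
        \<and> (\<forall>u. 1 \<le> u \<and> u < n \<longrightarrow> node_ok (ra s2 Key) (ia s2 Win) u)
        \<and> (\<forall>u. 2 \<le> u \<and> u < 2 * n \<longrightarrow> ia s2 Half u = u div 2) \<and> clk s2 \<le> 91 * n + 7 + 2"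
      \<comment> \<open>45 n + 6 for the setup and the first phase, 1 for the node counter, at most
        46 n + 2 for the tree, 13 for the nine operations of \<open>?C\<close>, and then the
        allowance for n greedy rounds.\<close>
      let ?T = "91 * n + 22 + (58 + 39 * lg (2 * n)) * n"
      define s3 where "s3 = s2\<lparr>clk := clk s2 + 13, ir := (ir s2)(iU := n + 1, iJ := n),
        rr := (rr s2)(fX := avg z 1 (n + 1) * real n, fY := 1, fBig := big_key, fZero := 0),
        ra := (ra s2)(Val := (ra s2 Val)(0 := 0))\<rparr>"
      have orc: "orc 1 (n + 1) = avg z 1 (n + 1)" using n_pos by (simp add: avg_oracle_def)
      have regs: "ir s2 iN = n" "ir s2 iOne = 1" "ir s2 iZero = 0" "ir s2 iTwo = 2"
        using s2 by (simp_all add: tables_def)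
      have C: "wp orc ?C P s2 \<longleftrightarrow> P s3" for P
      proof -
        have "s3 = ex orc (IPlus iJ iN iZero) (ex orc (RSt Val iZero fZero) (ex orc (RSet fZero 0)
          (ex orc (RPlus fBig fX fY) (ex orc (RSet fY 1) (ex orc (RTimes fX fX fY) (ex orc (ROf fY iN)
          (ex orc (RAvg fX iOne iU) (ex orc (IPlus iU iN iOne) s2))))))))"
          using regs orc by (simp add: s3_def big_key_def fun_eq_iff)
        then show ?thesis by (simp only: wp_seq wp_op ok.simps simp_thms)
      qed
      have e: "ir s3 iJ = n" "ir s3 iN = n" "ir s3 iOne = 1" "ir s3 iZero = 0" "ir s3 iTwo = 2" "ia s3 = ia s2"
        "rr s3 fB = K" "rr s3 fBig = big_key" "rr s3 fZero = 0" "clk s3 = clk s2 + 13" "ra s3 Key = ra s2 Key"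
        "ra s3 Val = ?V(0 := 0)"
        using s1 s2 regs by (simp_all add: s3_def base_def)
      have "tables s3" using s2 regs by (simp add: tables_def leaves_def e)
      moreover have "vals 0 s3"
        using s1 s2 assms(3) by (auto simp: vals_def e blocks_from_def)
      moreover have "\<forall>u. 1 \<le> u \<and> u < n \<longrightarrow> node_ok (ra s2 Key) (ia s2 Win) u"
        "\<forall>u. 2 \<le> u \<and> u < 2 * n \<longrightarrow> ia s2 Half u = u div 2" "clk s2 \<le> 91 * n + 7 + 2"
        using s2 by blast+
      ultimately have "greedy_inv ?T s3"
        unfolding greedy_inv_def e by simp
      then have "wp orc greedy_loop ?Q s3"
        by (rule wp_mono[OF wp_greedy_loop]) (auto simp: algebra_simps)
      then show "wp orc ?C (wp orc greedy_loop ?Q) s2" by (simp only: C)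
    qed
  qed
  then show ?thesis by (simp only: algorithm_def wp_seq)
qed

end

section \<open>Input and output\<close>

text \<open>Fixed cells can serve as registers only after the input has been moved out of their way.
  Until then \<open>rm 0\<close> is the only scratch register, so \<open>K\<close> is parked in cell \<open>4 n + 17\<close>; copying
  \<open>q\<close> downwards from \<open>n\<close>, and back upwards in the epilogue, never overwrites an unread cell.\<close>

definition load_setup :: "instr list" where
  "load_setup = [IConst 8 1, IConst 2 16, IAdd 3 0 0, IAdd 3 3 3, IAdd 3 3 2, IAdd 4 3 8,
     RStoreInd 4 0, IConst 6 4, IAdd 5 0 9]"

definition load_loop :: "instr list" where
  "load_loop = [IJumpLe 5 9 15, RLoadInd 0 5, RStoreInd 3 0, ISub 5 5 8, ISub 3 3 6, Jmp 9]"

definition store_setup :: "instr list" where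
  "store_setup = [IConst 8 1, IConst 6 4, IConst 3 20, IConst 5 1]"

definition store_loop :: "nat \<Rightarrow> instr list" where
  "store_loop e = [IJumpLe 5 0 (e + 2), Halt, RLoadInd 0 3, RStoreInd 5 0, IAdd 5 5 8, IAdd 3 3 6, Jmp e]"

definition program :: "instr list" where
  "program = (let k = compile 16 algorithm in
     load_setup @ load_loop @ [RLoadInd 0 4] @ k @ store_setup @ store_loop (20 + length k))"

definition load_ints :: "nat \<Rightarrow> nat \<Rightarrow> nat \<Rightarrow> int" where
  "load_ints n i = (\<lambda>_. 0)(0 := int n, 8 := 1, 2 := 16, 3 := 4 * int i + 16, 4 := 4 * int n + 17,
     6 := 4, 5 := int i)"

definition load_inv :: "nat \<Rightarrow> (nat \<Rightarrow> real) \<Rightarrow> real \<Rightarrow> nat \<Rightarrow> mstate \<Rightarrow> bool" where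
  "load_inv n q K i m \<longleftrightarrow> i \<le> n \<and> im m = load_ints n i \<and> rm m (4 * n + 17) = K
     \<and> (\<forall>k. 1 \<le> k \<and> k \<le> i \<longrightarrow> rm m k = q k) \<and> (\<forall>k. i < k \<and> k \<le> n \<longrightarrow> rm m (4 * k + 16) = q k)"

lemma load_body:
  assumes l: "located P 9 load_loop" and inv: "load_inv n q K (Suc i) m" and pc: "pc m = 9"
  shows "\<exists>m'. reaches orc P m 6 m' \<and> load_inv n q K i m' \<and> pc m' = 9"
proof -
  let ?b = "[RLoadInd 0 5, RStoreInd 3 0, ISub 5 5 8, ISub 3 3 6]"
  have I: "Suc i \<le> n" "im m = load_ints n (Suc i)" "rm m (4 * n + 17) = K"
    "\<And>k. 1 \<le> k \<Longrightarrow> k \<le> Suc i \<Longrightarrow> rm m k = q k"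
    "\<And>k. Suc i < k \<Longrightarrow> k \<le> n \<Longrightarrow> rm m (4 * k + 16) = q k"
    using inv by (auto simp: load_inv_def)
  have l1: "located P 9 (IJumpLe 5 9 15 # ?b @ [Jmp 9])" using l by (simp add: load_loop_def)
  note l2 = located_append[OF located_Cons(3)[OF l1]]
  have r1: "reaches orc P m 1 (m\<lparr>pc := 10\<rparr>)"
    using reaches_step[of P m "IJumpLe 5 9 15" _ orc] l1 pc I(2) by (simp add: load_ints_def)
  define m2 where "m2 = m\<lparr>pc := 14, im := load_ints n i,
    rm := (rm m)(0 := q (Suc i), 4 * Suc i + 16 := q (Suc i))\<rparr>"
  have ad: "nat (20 + 4 * int i) = 20 + 4 * i" "nat (1 + int i) = Suc i" by simp_all
  have fold: "fold (exec_instr orc) ?b (m\<lparr>pc := 10\<rparr>) = m2"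
    by (rule mstate.equality)
      (use I(4)[of "Suc i"] in \<open>simp_all add: m2_def I(2) load_ints_def fun_eq_iff ad\<close>)
  have "reaches orc P (m\<lparr>pc := 10\<rparr>) 4 m2"
    using reaches_plain[of P "m\<lparr>pc := 10\<rparr>" ?b orc] l2(1) fold by (simp add: eval_nat_numeral)
  note r2 = reaches_trans[OF r1 this]
  have "reaches orc P m2 1 (m2\<lparr>pc := 9\<rparr>)"
    using reaches_step[of P m2 "Jmp 9" "[]" orc] l2(2) by (simp add: m2_def)
  note r3 = reaches_trans[OF r2 this]
  \<comment> \<open>K is parked at an address congruent to 1 modulo 4, while \<open>q\<close> goes
    to multiples of 4.\<close>
  have "4 * n + 17 \<noteq> 4 * Suc i + 16" by presburger
  then have "rm m2 (4 * n + 17) = K" using I(3) by (simp add: m2_def)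
  moreover have "rm m2 (4 * k + 16) = q k" if "i < k" "k \<le> n" for k
    using I(5)[of k] that by (cases "k = Suc i") (simp_all add: m2_def)
  moreover have "rm m2 k = q k" if "1 \<le> k" "k \<le> i" for k
    using I(4)[of k] that by (simp add: m2_def)
  ultimately have "load_inv n q K i (m2\<lparr>pc := 9\<rparr>)"
    using I(1) by (simp add: load_inv_def) (simp add: m2_def)
  with r3 show ?thesis by force
qed

lemma load_run:
  assumes "located P 9 load_loop" "load_inv n q K i m" "pc m = 9"
  shows "\<exists>m'. reaches orc P m (6 * i + 1) m' \<and> load_inv n q K 0 m' \<and> pc m' = 15"
  using assms(2,3)
proof (induction i arbitrary: m)
  case 0
  have "reaches orc P m 1 (m\<lparr>pc := 15\<rparr>)"
    using reaches_step[of P m "IJumpLe 5 9 15" _ orc] assms(1) 0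
    by (simp add: load_loop_def load_inv_def load_ints_def)
  moreover have "load_inv n q K 0 (m\<lparr>pc := 15\<rparr>)" using 0 by (simp add: load_inv_def)
  ultimately show ?case by force
next
  case (Suc i)
  obtain m1 where m1: "reaches orc P m 6 m1" "load_inv n q K i m1" "pc m1 = 9"
    using load_body[OF assms(1) Suc.prems] by blast
  obtain m' where m': "reaches orc P m1 (6 * i + 1) m'" "load_inv n q K 0 m'" "pc m' = 15"
    using Suc.IH[OF m1(2,3)] by blast
  have "6 + (6 * i + 1) = 6 * Suc i + 1" by simp
  with reaches_trans[OF m1(1) m'(1)] m'(2,3) show ?case by metis
qed

text \<open>The target i lies below every unread source cell \<open>4 * k + 16\<close>. The exit
  test reads n from cell 0, which is why \<open>wp_algorithm\<close> also asserts
  \<open>ir s' iN = n\<close>.\<close>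

definition store_inv :: "nat \<Rightarrow> (nat \<Rightarrow> real) \<Rightarrow> nat \<Rightarrow> mstate \<Rightarrow> bool" where
  "store_inv n x i m \<longleftrightarrow> 1 \<le> i \<and> i \<le> n + 1 \<and> im m 0 = int n \<and> im m 8 = 1 \<and> im m 6 = 4 \<and> im m 5 = int i
     \<and> im m 3 = 4 * int i + 16 \<and> (\<forall>k. 1 \<le> k \<and> k < i \<longrightarrow> rm m k = x k)
     \<and> (\<forall>k. i \<le> k \<and> k \<le> n \<longrightarrow> rm m (4 * k + 16) = x k)"

lemma store_body:
  assumes l: "located P e (store_loop e)" and inv: "store_inv n x i m" and "i \<le> n" and pc: "pc m = e"
  shows "\<exists>m'. reaches orc P m 6 m' \<and> store_inv n x (Suc i) m' \<and> pc m' = e"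
proof -
  let ?b = "[RLoadInd 0 3, RStoreInd 5 0, IAdd 5 5 8, IAdd 3 3 6]"
  have I: "1 \<le> i" "im m 0 = int n" "im m 8 = 1" "im m 6 = 4" "im m 5 = int i"
    "im m 3 = 4 * int i + 16" "\<And>k. 1 \<le> k \<Longrightarrow> k < i \<Longrightarrow> rm m k = x k"
    "\<And>k. i \<le> k \<Longrightarrow> k \<le> n \<Longrightarrow> rm m (4 * k + 16) = x k"
    using inv by (auto simp: store_inv_def)
  have l1: "located P e ([IJumpLe 5 0 (e + 2), Halt] @ ?b @ [Jmp e])" using l by (simp add: store_loop_def)
  have l2: "located P (e + 2) ?b" "located P (e + 6) [Jmp e]"
    using located_append(1)[OF located_append(2)[OF l1]] located_append(2)[OF located_append(2)[OF l1]]
    by (simp_all add: eval_nat_numeral)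
  have r1: "reaches orc P m 1 (m\<lparr>pc := e + 2\<rparr>)"
    using reaches_step[of P m "IJumpLe 5 0 (e + 2)" _ orc] l1 pc I(2,5) \<open>i \<le> n\<close> by simp
  define m2 where "m2 = m\<lparr>pc := e + 6, im := (im m)(5 := int (Suc i), 3 := 4 * int (Suc i) + 16),
    rm := (rm m)(0 := x i, i := x i)\<rparr>"
  have ad: "nat (4 * int i + 16) = 4 * i + 16" by simp
  have fold: "fold (exec_instr orc) ?b (m\<lparr>pc := e + 2\<rparr>) = m2"
    by (rule mstate.equality)
      (use I(8)[of i] \<open>i \<le> n\<close> in \<open>simp_all add: m2_def I(3-6) ad fun_eq_iff\<close>)
  have "reaches orc P (m\<lparr>pc := e + 2\<rparr>) 4 m2"
    using reaches_plain[of P "m\<lparr>pc := e + 2\<rparr>" ?b orc] l2(1) fold by (simp add: eval_nat_numeral)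
  note r2 = reaches_trans[OF r1 this]
  have "reaches orc P m2 1 (m2\<lparr>pc := e\<rparr>)"
    using reaches_step[of P m2 "Jmp e" "[]" orc] l2(2) by (simp add: m2_def)
  note r3 = reaches_trans[OF r2 this]
  have "store_inv n x (Suc i) (m2\<lparr>pc := e\<rparr>)"
    using I \<open>i \<le> n\<close> by (auto simp: store_inv_def m2_def less_Suc_eq)
  with r3 show ?thesis by (force simp: m2_def)
qed

lemma store_run:
  assumes "located P e (store_loop e)" "store_inv n x i m" "pc m = e"
  shows "\<exists>m'. reaches orc P m (6 * (n + 1 - i) + 1) m' \<and> (\<forall>k. 1 \<le> k \<and> k \<le> n \<longrightarrow> rm m' k = x k)
    \<and> halted P m'"
  using assms(2,3)
proof (induction "n + 1 - i" arbitrary: i m)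
  case 0
  then have i: "i = n + 1" by (simp add: store_inv_def)
  have "reaches orc P m 1 (m\<lparr>pc := Suc e\<rparr>)"
    using reaches_step[of P m "IJumpLe 5 0 (e + 2)" _ orc] assms(1) 0(2,3) i
    by (simp add: store_loop_def store_inv_def)
  moreover have "halted P (m\<lparr>pc := Suc e\<rparr>)"
    using located_Cons(2)[OF located_Cons(3)[OF assms(1)[unfolded store_loop_def]]] by (simp add: halted_def)
  ultimately show ?case using 0 i by (force simp: store_inv_def)
next
  case (Suc d)
  then have "i \<le> n" by simp
  obtain m1 where m1: "reaches orc P m 6 m1" "store_inv n x (Suc i) m1" "pc m1 = e"
    using store_body[OF assms(1) Suc.prems(1) \<open>i \<le> n\<close> Suc.prems(2)] by blast
  have "d = n + 1 - Suc i" using Suc.hyps(2) by simp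
  from Suc.hyps(1)[OF this m1(2,3)] obtain m' where
    m': "reaches orc P m1 (6 * (n + 1 - Suc i) + 1) m'" "\<forall>k. 1 \<le> k \<and> k \<le> n \<longrightarrow> rm m' k = x k" "halted P m'"
    by blast
  have "6 + (6 * (n + 1 - Suc i) + 1) = 6 * (n + 1 - i) + 1" using \<open>i \<le> n\<close> by simp
  with reaches_trans[OF m1(1) m'(1)] m'(2,3) show ?case by metis
qed

section \<open>The assembled program and its running time\<close>

lemma program_located:
  defines "k \<equiv> compile 16 algorithm"
  shows "located program 0 load_setup" "located program 9 load_loop" "located program 15 [RLoadInd 0 4]"
    "located program 16 k" "located program (16 + length k) store_setup"
    "located program (20 + length k) (store_loop (20 + length k))"
proof -
  have "located program 0 (load_setup @ load_loop @ [RLoadInd 0 4] @ k @ store_setup @ store_loop (20 + length k))"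
    unfolding located_def program_def k_def Let_def by (intro exI[of _ "[]"]) simp
  note 1 = located_append[OF this]
  note 2 = located_append[OF 1(2)]
  note 3 = located_append[OF 2(2)]
  note 4 = located_append[OF 3(2)]
  note 5 = located_append[OF 4(2)]
  have len: "length load_setup = 9" "length load_loop = 6" "length store_setup = 4"
    by (simp_all add: load_setup_def load_loop_def store_setup_def)
  show "located program 0 load_setup" "located program 9 load_loop" "located program 15 [RLoadInd 0 4]"
    "located program 16 k" "located program (16 + length k) store_setup"
    "located program (20 + length k) (store_loop (20 + length k))"
    using 1(1) 2(1) 3(1) 4(1) 5 by (simp_all add: len add.commute)
qed

text \<open>From \<open>2 ^ lg (2 * n) \<le> 2 * n\<close> it follows that (lg - 1) ln 2 \<le> ln n.
  Since e \<le> 3, ln 4 \<ge> ln 3 \<ge> 1 and thus ln 2 \<ge> 1/2, so lg \<le> 1 + 2 ln n \<le> 3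
  ln n.\<close>

lemma lg_le_ln:
  assumes "3 \<le> n"
  shows "real (lg (2 * n)) \<le> 3 * ln (real n)" "1 \<le> ln (real n)"
proof -
  have "ln (exp 1) \<le> ln (3 :: real)" using exp_le by (subst ln_le_cancel_iff) auto
  then have ln3: "1 \<le> ln (3 :: real)" by simp
  also have "\<dots> \<le> ln (real n)" using assms by simp
  finally show n1: "1 \<le> ln (real n)" .
  have "ln (4 :: real) = ln (2 ^ 2)" by simp
  also have "\<dots> = 2 * ln 2" by (subst ln_realpow) auto
  finally have ln2: "1 / 2 \<le> ln (2 :: real)" using ln3 ln_le_cancel_iff[of 3 "4::real"] by simp
  have "real (lg (2 * n)) * ln 2 = ln (2 ^ lg (2 * n))" by (simp add: ln_realpow)
  also have "\<dots> \<le> ln (real (2 * n))"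
  proof (subst ln_le_cancel_iff)
    have "real (2 ^ lg (2 * n)) \<le> real (2 * n)"
      using two_power_lg[of "2 * n"] assms by (subst of_nat_le_iff) simp
    then show "2 ^ lg (2 * n) \<le> real (2 * n)" by simp
  qed (use assms in auto)
  also have "\<dots> = ln 2 + ln (real n)" using assms by (simp add: ln_mult)
  finally have *: "(real (lg (2 * n)) - 1) * ln 2 \<le> ln (real n)" by (simp add: algebra_simps)
  have "real (lg (2 * n)) - 1 \<le> 2 * ln (real n)"
  proof (cases "real (lg (2 * n)) - 1 \<le> 0")
    case False
    then have "(real (lg (2 * n)) - 1) * (1 / 2) \<le> (real (lg (2 * n)) - 1) * ln 2"
      using ln2 by (intro mult_left_mono) auto
    with * show ?thesis by simp
  qed (use n1 in linarith)
  with n1 show "real (lg (2 * n)) \<le> 3 * ln (real n)" by linarith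
qed

lemma program_correct:
  assumes "instance_P n q z K"
  shows "\<exists>t m'. reaches (avg_oracle z n) program (init_state n q z K) t m' \<and> halted program m'
    \<and> (\<forall>k. 1 \<le> k \<and> k \<le> n \<longrightarrow> rm m' k = alg2 q z n K k) \<and> t \<le> (161 + 39 * lg (2 * n)) * n + 40"
proof -
  interpret problem n q z K by unfold_locales (rule assms)
  let ?x = "alg2 q z n K"
  let ?orc = "avg_oracle z n"
  let ?e = "16 + length (compile 16 algorithm)"
  let ?m0 = "init_state n q z K"
  define m1 where "m1 = fold (exec_instr ?orc) load_setup ?m0"
  have prep: "length load_setup = 9" "\<forall>i\<in>set load_setup. plain i" "pc ?m0 = 0"
    "length store_setup = 4" "\<forall>i\<in>set store_setup. plain i"
    by (simp_all add: load_setup_def store_setup_def init_state_def)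
  have r1: "reaches ?orc program ?m0 9 m1" "pc m1 = 9"
    using reaches_plain[of program ?m0 load_setup ?orc] steps_plain[of program ?m0 load_setup ?orc]
      program_located(1) prep by (simp_all add: m1_def)
  have "nat (17 + 4 * int n) = 4 * n + 17" by simp
  then have "load_inv n q K n m1"
    unfolding m1_def load_setup_def init_state_def
    by (simp add: load_inv_def load_ints_def fun_eq_iff)
  from load_run[OF program_located(2) this r1(2), of ?orc] obtain m2 where
    m2: "reaches ?orc program m1 (6 * n + 1) m2" "load_inv n q K 0 m2" "pc m2 = 15" by blast
  define m3 where "m3 = m2\<lparr>pc := 16, rm := (rm m2)(0 := K)\<rparr>"
  have "reaches ?orc program m2 1 m3"
    using reaches_step[of program m2 "RLoadInd 0 4" "[]" ?orc] program_located(3) m2(2,3)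
    by (simp add: m3_def load_inv_def load_ints_def nat_add_distrib nat_mult_distrib)
  note r3 = reaches_trans[OF reaches_trans[OF r1(1) m2(1)] this]
  \<comment> \<open>The source state is read off the memory. \<open>nat\<close> loses nothing as no
    integer cell is negative, and integer cells from 16 on are still 0, so the parent table starts
    empty.\<close>
  define s where "s = \<lparr>clk = 0, ir = (\<lambda>r. nat (im m3 (icell r))), ia = (\<lambda>a k. nat (im m3 (4 * k + ioff a))),
    rr = (\<lambda>r. rm m3 (rcell r)), ra = (\<lambda>a k. rm m3 (4 * k + roff a))\<rparr>"
  have "0 \<le> im m3 a" for a
    using m2(2) by (simp add: m3_def load_inv_def load_ints_def)
  then have mod: "models m3 s" by (simp add: models_def s_def)
  have "wp ?orc algorithm (\<lambda>s'. ir s' iN = n \<and> (\<forall>k. 1 \<le> k \<and> k \<le> n \<longrightarrow> ra s' Val k = ?x k)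
    \<and> clk s' \<le> (149 + 39 * lg (2 * n)) * n + 24) s"
    by (rule wp_algorithm)
      (use m2(2) in \<open>simp_all add: s_def m3_def load_inv_def load_ints_def\<close>)
  then obtain s' where s': "big ?orc algorithm s s'" "ir s' iN = n"
    "\<And>k. 1 \<le> k \<Longrightarrow> k \<le> n \<Longrightarrow> ra s' Val k = ?x k" "clk s' \<le> (149 + 39 * lg (2 * n)) * n + 24"
    unfolding wp_def by blast
  obtain t m4 where m4: "reaches ?orc program m3 t m4" "t = clk s'" "models m4 s'" "pc m4 = ?e"
    using compile_correct[OF s'(1) mod, of program] program_located(4) by (auto simp: m3_def s_def)
  define m5 where "m5 = fold (exec_instr ?orc) store_setup m4"
  have r5: "reaches ?orc program m4 4 m5" "pc m5 = ?e + 4"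
    using reaches_plain[of program m4 store_setup ?orc] steps_plain[of program m4 store_setup ?orc]
      program_located(5) m4(4) prep by (simp_all add: m5_def)
  have "im m4 0 = int n" using m4(3) s'(2) unfolding models_def by (metis icell.simps(1))
  moreover have "rm m4 (4 * k + 16) = ?x k" if "1 \<le> k" "k \<le> n" for k
    using m4(3) s'(3)[OF that] unfolding models_def by (metis roff.simps(1))
  ultimately have "store_inv n ?x 1 m5"
    by (simp add: m5_def store_setup_def store_inv_def)
  moreover have "pc m5 = 20 + length (compile 16 algorithm)" using r5(2) by simp
  ultimately obtain m6 where m6: "reaches ?orc program m5 (6 * n + 1) m6"
    "\<forall>k. 1 \<le> k \<and> k \<le> n \<longrightarrow> rm m6 k = ?x k" "halted program m6"
    using store_run[OF program_located(6), of n ?x 1 m5 ?orc] by auto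
  note r = reaches_trans[OF reaches_trans[OF reaches_trans[OF r3 m4(1)] r5(1)] m6(1)]
  \<comment> \<open>Moving input and output adds 12 n + 16 steps to those of the compiled
    algorithm.\<close>
  have "9 + (6 * n + 1) + 1 + t + 4 + (6 * n + 1) \<le> (161 + 39 * lg (2 * n)) * n + 40"
    using s'(4) m4(2) by (simp add: algebra_simps)
  with r m6(2,3) show ?thesis by blast
qed

theorem theorem5:
  "\<exists>(P :: instr list) (C :: real) (N0 :: nat).
     \<forall>n q z K. instance_P n q z K \<longrightarrow>
       (\<exists>t. halted P ((step (avg_oracle z n) P ^^ t) (init_state n q z K))
            \<and> (\<forall>i\<in>{1..n}. rm ((step (avg_oracle z n) P ^^ t) (init_state n q z K)) i
                             = alg2 q z n K i)
            \<and> (n \<ge> N0 \<longrightarrow> real t \<le> C * real n * ln (real n)))"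
proof (rule exI[of _ program], rule exI[of _ 318], rule exI[of _ 3], intro allI impI)
  fix n q z K
  assume "instance_P n q z K"
  then obtain t m' where t: "reaches (avg_oracle z n) program (init_state n q z K) t m'" "halted program m'"
    "\<forall>k. 1 \<le> k \<and> k \<le> n \<longrightarrow> rm m' k = alg2 q z n K k" "t \<le> (161 + 39 * lg (2 * n)) * n + 40"
    using program_correct by blast
  have "real t \<le> 318 * real n * ln (real n)" if "3 \<le> n"
  proof -
    note b = lg_le_ln[OF that]
    have "real t \<le> real ((161 + 39 * lg (2 * n)) * n + 40)"
      using t(4) by (simp only: of_nat_le_iff)
    also have "\<dots> \<le> (161 + 39 * real (lg (2 * n))) * real n + 40 * real n"
      using that by simp
    also have "\<dots> = (201 + 39 * real (lg (2 * n))) * real n"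
      by (simp add: algebra_simps)
    \<comment> \<open>318 = 201 + 39 * 3; the summand 201 is absorbed by
      \<open>1 \<le> ln (real n)\<close>, which is where 3 \<le> n enters.\<close>
    also have "\<dots> \<le> (318 * ln (real n)) * real n"
      using b by (intro mult_right_mono) auto
    finally show ?thesis by (simp add: mult.commute mult.left_commute)
  qed
  with t show "\<exists>t. halted program ((step (avg_oracle z n) program ^^ t) (init_state n q z K))
    \<and> (\<forall>i\<in>{1..n}. rm ((step (avg_oracle z n) program ^^ t) (init_state n q z K)) i = alg2 q z n K i)
    \<and> (3 \<le> n \<longrightarrow> real t \<le> 318 * real n * ln (real n))"
    unfolding reaches_def by (intro exI[of _ t]) auto
qed

end
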